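(* For every positive integer $d$, $$RTB^*(d)\ \geq\ 1+\frac{1}{2^{d-2}},$$ where $RTB^*(d)=\inf\{E^*(\mathbf{v}) : \mathbf{v}\text{ is a balanced sequence over a } d\text{-ary alphabet}\}$.
   Context: A sequence over a finite alphabet is an infinite string $\mathbf{v}=v_0v_1v_2\cdots$ of letters; a factor is a finite block of consecutive letters. For a word $w$ and a letter $a$, $|w|_a$ is the number of occurrences of $a$ in $w$. A sequence is balanced if for every letter $a$ and any two of its factors $u,v$ of equal length, $|u|_a-|v|_a\le 1$. If $u$ is a non-empty word of length $\ell$ and $e=n/\ell$ is a positive rational number, $u^e$ denotes the prefix of length $n$ of $uuu\cdots$. The critical exponent is $E(\mathbf{v})=\sup\{e\in\mathbb{Q}: u^e \text{ is a factor of } \mathbf{v} \text{ for some non-empty word } u\}$. The asymptotic critical exponent $E^*(\mathbf{v})$ is $+\infty$ if $E(\mathbf{v})=+\infty$, and otherwise $E^*(\mathbf{v})=\limsup_{n\to\infty} e_n$, where $e_n=\sup\{e\in\mathbb{Q}: u^e \text{ is a factor of }\mathbf{v}\text{ for some word } u \text{ of length } n\}$. *)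

theory Defs
  imports Complex_Main "HOL-Library.Omega_Words_Fun" "HOL-Library.Extended_Real"
    "HOL-Library.Liminf_Limsup"
begin

definition factors :: "'a word \<Rightarrow> 'a list set" where
  "factors v = {v [i \<rightarrow> j] | i j. i \<le> j}"

definition balanced :: "'a word \<Rightarrow> bool" where
  "balanced v \<longleftrightarrow>
     (\<forall>a. \<forall>u \<in> factors v. \<forall>w \<in> factors v. length u = length w \<longrightarrow>
        int (count_list u a) - int (count_list w a) \<le> 1)"

text \<open>The exponents \<open>e\<close> such that the fractional power of \<open>u\<close> with exponent \<open>e = n / length u\<close>,
  i.e. the prefix of length \<open>n\<close> of the infinite repetition of \<open>u\<close>, is a factor of \<open>v\<close>.
  Only meaningful for non-empty \<open>u\<close>.\<close>

definition power_exponents :: "'a word \<Rightarrow> 'a list \<Rightarrow> rat set" where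
  "power_exponents v u =
     {of_nat n / of_nat (length u) | n. n > 0 \<and> prefix n (u\<^sup>\<omega>) \<in> factors v}"

definition critical_exponent :: "'a word \<Rightarrow> ereal" where
  "critical_exponent v = Sup {ereal (of_rat e) | e u. u \<noteq> [] \<and> e \<in> power_exponents v u}"

text \<open>At \<open>n = 0\<close> the set is empty and the supremum is \<open>-\<infinity>\<close>; this does not affect the limes superior
  below.\<close>

definition critical_exponent_at :: "'a word \<Rightarrow> nat \<Rightarrow> ereal" where
  "critical_exponent_at v n =
     Sup {ereal (of_rat e) | e u. u \<noteq> [] \<and> length u = n \<and> e \<in> power_exponents v u}"

definition asymptotic_critical_exponent :: "'a word \<Rightarrow> ereal" where
  "asymptotic_critical_exponent v =
     (if critical_exponent v = \<infinity> then \<infinity> else limsup (critical_exponent_at v))"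

text \<open>Letters are natural numbers, which is no restriction since alphabets are finite.
  Not every letter of the alphabet is required to occur in the sequence.\<close>

definition RTB_star :: "nat \<Rightarrow> ereal" where
  "RTB_star d =
     Inf {asymptotic_critical_exponent v | (v :: nat word) A.
            finite A \<and> card A = d \<and> range v \<subseteq> A \<and> balanced v}"

end

theory Submission
  imports Defs "HOL-Computational_Algebra.Primes" "HOL-Analysis.Kronecker_Approximation_Theorem"
begin

text \<open>
  Let \<open>c\<^sub>a i\<close> count the letter \<open>a\<close> before position \<open>i\<close>. In a balanced word \<open>c\<^sub>a i - i \<rho>\<^sub>a\<close> stays in an
  interval of length 1. If all frequencies \<open>\<rho>\<^sub>a\<close> are rational, the word is eventually periodic and its
  critical exponent is infinite. Otherwise choose \<open>t\<close> such that all \<open>t \<rho>\<^sub>a\<close> are very close to integers,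
  and let \<open>A\<close> consist of the letters for which \<open>t \<rho>\<^sub>a\<close> is not below its integer. The word and its shift by \<open>t\<close>
  then differ only by transpositions of adjacent letters, one from \<open>A\<close> and one from the complement, so
  the subword of the letters in \<open>A\<close> and the subword of the other letters are both periodic.

  Let \<open>\<alpha>\<close> be the frequency of \<open>A\<close>. The pairs (number of letters in \<open>A\<close>, number of other letters)
  form a lattice path. Whether the next step is in \<open>A\<close> is decided by comparing \<open>c\<^sub>A i - i \<alpha>\<close> with a
  threshold that depends on either one of the two residues of the pair modulo the periods, and density
  of \<open>\<int>(1 - \<alpha>) + \<int>\<alpha>\<close> forces all thresholds to agree. Hence every letter has a constant gap in its
  subword. Such a subword on \<open>k\<close> letters partitions the integers into \<open>k\<close> residue classes and therefore
  has a period of at most \<open>2\<^bsup>k-1\<^esup>\<close>. With periods \<open>P\<close> and \<open>Q\<close> of the two subwords, Dirichlet's theorem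
  yields arbitrarily large \<open>t = m P + n Q\<close> with \<open>t \<bar>t \<alpha> - m P\<bar>\<close> at most about \<open>P Q\<close>, and the proportion of
  places where the word differs from its shift by \<open>t\<close> is governed by \<open>\<bar>t \<alpha> - m P\<bar>\<close>. So there is a run
  of agreement of length about \<open>t / (P Q)\<close>, where \<open>P Q \<le> 2\<^bsup>d-2\<^esup>\<close>.
\<close>

section \<open>Letter counts and frequencies\<close>

definition cnt :: "'a set \<Rightarrow> 'a word \<Rightarrow> nat \<Rightarrow> nat" where
  "cnt S v i = card {j. j < i \<and> v j \<in> S}"

lemma cnt_0 [simp]: "cnt S v 0 = 0" by (simp add: cnt_def)

lemma cnt_Suc: "cnt S v (Suc i) = cnt S v i + (if v i \<in> S then 1 else 0)"
proof -
  have "{j. j < Suc i \<and> v j \<in> S} = {j. j < i \<and> v j \<in> S} \<union> (if v i \<in> S then {i} else {})"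
    by (auto simp: less_Suc_eq)
  thus ?thesis by (simp add: cnt_def)
qed

lemma cnt_mono: "i \<le> j \<Longrightarrow> cnt S v i \<le> cnt S v j"
  unfolding cnt_def by (rule card_mono) auto

lemma cnt_shift: "cnt S v (k + i) = cnt S v k + cnt S (\<lambda>n. v (k + n)) i"
  by (induction i) (auto simp: cnt_Suc)

lemma cnt_eq_sum: "finite S \<Longrightarrow> cnt S v i = (\<Sum>a\<in>S. cnt {a} v i)"
  by (induction i) (auto simp: cnt_Suc sum.distrib)

lemma cnt_compl: "cnt (- S) v i = i - cnt S v i" "cnt S v i \<le> i"
proof -
  have "cnt (- S) v i + cnt S v i = i" by (induction i) (auto simp: cnt_Suc)
  thus "cnt (- S) v i = i - cnt S v i" "cnt S v i \<le> i" by auto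
qed

lemma cnt_eq_imp_eq: "v i \<in> S \<Longrightarrow> v j \<in> S \<Longrightarrow> cnt S v i = cnt S v j \<Longrightarrow> i = j"
proof (induction i j rule: linorder_wlog)
  case (le i j)
  show ?case
  proof (rule ccontr)
    assume "i \<noteq> j"
    hence "cnt S v (Suc i) \<le> cnt S v j" using le by (intro cnt_mono) auto
    thus False using le by (simp add: cnt_Suc)
  qed
qed auto

text \<open>Counts start at 0 and rise by at most 1, so every smaller value is left at an occurrence
  of a letter of \<open>S\<close>. This locates the occurrence with index \<open>n\<close>.\<close>

lemma cnt_crossing:
  assumes "cnt S v i > n"
  shows "\<exists>j<i. v j \<in> S \<and> cnt S v j = n"
  using assms
proof (induction i)
  case (Suc i)
  show ?case
  proof (cases "cnt S v i > n")
    case True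
    thus ?thesis using Suc.IH less_SucI by blast
  next
    case False
    hence "v i \<in> S \<and> cnt S v i = n" using Suc.prems by (auto simp: cnt_Suc split: if_splits)
    thus ?thesis by auto
  qed
qed simp

lemma count_list_subsequence: "cnt {a} v i + count_list (v [i \<rightarrow> i + n]) a = cnt {a} v (i + n)"
proof (induction n)
  case (Suc n)
  have "v [i \<rightarrow> i + Suc n] = v [i \<rightarrow> i + n] @ [v (i + n)]" by (simp add: subsequence_def)
  thus ?case using Suc by (auto simp: cnt_Suc)
qed (simp add: subsequence_def)

lemma balanced_cnt:
  assumes "balanced v"
  shows "cnt {a} v (i + n) + cnt {a} v j \<le> cnt {a} v (j + n) + cnt {a} v i + 1"
proof -
  have "v [i \<rightarrow> i + n] \<in> factors v" "v [j \<rightarrow> j + n] \<in> factors v" by (auto simp: factors_def intro!: exI)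
  hence "int (count_list (v [i \<rightarrow> i + n]) a) - int (count_list (v [j \<rightarrow> j + n]) a) \<le> 1"
    using assms unfolding balanced_def by simp
  thus ?thesis using count_list_subsequence[of a v i n] count_list_subsequence[of a v j n] by linarith
qed

section \<open>Frequencies with bounded discrepancy\<close>

definition bounded_discrepancy :: "(nat \<Rightarrow> nat) \<Rightarrow> real \<Rightarrow> real \<Rightarrow> bool" where
  "bounded_discrepancy c \<rho> x \<longleftrightarrow> (\<forall>i. x - 1 \<le> real (c i) - real i * \<rho> \<and> real (c i) - real i * \<rho> \<le> x)"

text \<open>All counts in windows of length \<open>n\<close> lie between their infimum
  \<open>lo n\<close> and \<open>lo n + 1\<close>. The intervals from \<open>lo n / n\<close> to
  \<open>(lo n + 1) / n\<close> have a common point, the frequency, and comparing with it shows that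
  any two discrepancies differ by at most 1.\<close>

lemma balanced_imp_bounded_discrepancy:
  fixes c :: "nat \<Rightarrow> nat"
  assumes mono: "\<And>i j. i \<le> j \<Longrightarrow> c i \<le> c j"
    and bal: "\<And>i j n. c (i + n) + c j \<le> c (j + n) + c i + 1"
  shows "\<exists>\<rho> x. \<rho> \<ge> 0 \<and> bounded_discrepancy c \<rho> x"
proof -
  define e where "e i n = real (c (i + n)) - real (c i)" for i n
  define lo where "lo n = (INF i. e i n)" for n
  have e0: "e i n \<ge> 0" for i n using mono[of i "i + n"] by (simp add: e_def)
  have bdd: "bdd_below (range (\<lambda>i. e i n))" for n by (rule bdd_belowI[of _ 0]) (use e0 in auto)
  have lo: "lo n \<le> e i n" for i n unfolding lo_def by (rule cINF_lower[OF bdd]) simp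
  have hi: "e i n \<le> lo n + 1" for i n
  proof -
    have "e i n - 1 \<le> lo n" unfolding lo_def
    proof (rule cINF_greatest)
      fix j show "e i n - 1 \<le> e j n" using bal[of i n j] unfolding e_def by linarith
    qed simp
    thus ?thesis by simp
  qed
  have split: "e 0 (m * n) = (\<Sum>l<m. e (l * n) n)" for m n
    by (induction m) (auto simp: e_def algebra_simps)
  \<comment> \<open>The prefix of length \<open>m * n\<close> is cut both into \<open>m\<close>
    blocks of length \<open>n\<close> and into \<open>n\<close> blocks of length
    \<open>m\<close>.\<close>
  have cross: "real m * lo n \<le> real n * (lo m + 1)" for m n
  proof -
    have "real m * lo n \<le> e 0 (m * n)" unfolding split
      using sum_bounded_below[of "{..<m}" "lo n" "\<lambda>l. e (l * n) n"] lo by simp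
    also have "\<dots> = e 0 (n * m)" by (simp add: mult.commute)
    also have "\<dots> \<le> real n * (lo m + 1)" unfolding split
      using sum_bounded_above[of "{..<n}" "\<lambda>l. e (l * m) m" "lo m + 1"] hi by simp
    finally show ?thesis .
  qed
  define \<rho> where "\<rho> = (SUP n\<in>{1..}. lo n / real n)"
  have up: "lo n / real n \<le> (lo m + 1) / real m" if "n \<ge> 1" "m \<ge> 1" for n m
    using cross[of m n] that by (simp add: field_simps)
  have bdd2: "bdd_above ((\<lambda>n. lo n / real n) ` {1..})"
    by (rule bdd_aboveI[of _ "(lo 1 + 1) / real 1"]) (use up[of _ 1] in auto)
  have r1: "lo n \<le> real n * \<rho>" if "n \<ge> 1" for n
  proof -
    have "lo n / real n \<le> \<rho>" unfolding \<rho>_def by (rule cSUP_upper[OF _ bdd2]) (use that in auto)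
    thus ?thesis using that by (simp add: field_simps)
  qed
  have r2: "real n * \<rho> \<le> lo n + 1" if "n \<ge> 1" for n
  proof -
    have "\<rho> \<le> (lo n + 1) / real n" unfolding \<rho>_def by (rule cSUP_least) (use up that in auto)
    thus ?thesis using that by (simp add: field_simps)
  qed
  define \<delta> where "\<delta> i = real (c i) - real i * \<rho>" for i
  have close: "\<delta> i - \<delta> j \<le> 1 \<and> \<delta> j - \<delta> i \<le> 1" if "i < j" for i j
  proof -
    have "j - i \<ge> 1" using that by simp
    note r1[OF this] r2[OF this] lo[of "j - i" i] hi[of i "j - i"]
    moreover have "e i (j - i) - real (j - i) * \<rho> = \<delta> j - \<delta> i"
      using that by (simp add: e_def \<delta>_def algebra_simps of_nat_diff)
    ultimately show ?thesis by linarith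
  qed
  have close': "\<delta> i - \<delta> j \<le> 1" for i j
    using close[of i j] close[of j i] by (cases i j rule: linorder_cases) auto
  define x where "x = (SUP i. \<delta> i)"
  have bdd3: "bdd_above (range \<delta>)"
    by (rule bdd_aboveI[of _ "\<delta> 0 + 1"]) (use close'[of _ 0] in \<open>auto simp: algebra_simps\<close>)
  have "\<delta> i \<le> x" for i unfolding x_def by (rule cSUP_upper[OF _ bdd3]) simp
  moreover have "x \<le> \<delta> i + 1" for i unfolding x_def
    by (rule cSUP_least) (use close'[of _ i] in \<open>auto simp: algebra_simps\<close>)
  moreover have "\<rho> \<ge> 0"
    using r2[of 1] r1[of 1] lo e0 unfolding lo_def
    by (smt (verit) cINF_greatest UNIV_not_empty One_nat_def le_refl mult_cancel_right1 of_nat_1)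
  ultimately show ?thesis
    unfolding bounded_discrepancy_def \<delta>_def by (intro exI[of _ \<rho>] exI[of _ x]) (auto simp: algebra_simps)
qed

text \<open>\<open>d i\<close> is the deviation of the window of length \<open>q\<close> at
  \<open>i\<close> from its mean \<open>p\<close>. Its values differ by at most 1, so nonzero ones
  share a sign, and sums along steps of \<open>q\<close> telescope to differences of discrepancies.
  Two nonzero values in one residue class modulo \<open>q\<close> would give a sum of absolute value
  at least 2, so only finitely many are nonzero.\<close>

lemma rational_frequency_eventually_periodic:
  fixes c :: "nat \<Rightarrow> nat"
  assumes bal: "\<And>i j n. c (i + n) + c j \<le> c (j + n) + c i + 1"
    and disc: "bounded_discrepancy c \<rho> x" and q: "q > 0" "real q * \<rho> = of_int p"
  shows "\<exists>K. \<forall>i\<ge>K. int (c (i + q)) = int (c i) + p"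
proof -
  define d where "d i = int (c (i + q)) - int (c i) - p" for i
  have dd: "d i - d j \<le> 1" for i j using bal[of i q j] by (simp add: d_def)
  have tel: "(\<Sum>l<k. d (i + l * q)) = int (c (i + k * q)) - int (c i) - int k * p" for i k
    by (induction k) (auto simp: d_def algebra_simps)
  have tel1: "\<bar>\<Sum>l<k. d (i + l * q)\<bar> \<le> 1" for i k
  proof -
    have "real_of_int (\<Sum>l<k. d (i + l * q)) =
      (real (c (i + k * q)) - real (i + k * q) * \<rho>) - (real (c i) - real i * \<rho>)"
      unfolding tel using q(2) by (simp add: algebra_simps)
    hence "\<bar>real_of_int (\<Sum>l<k. d (i + l * q))\<bar> \<le> 1"
      using disc unfolding bounded_discrepancy_def by (smt (verit))
    thus ?thesis by linarith
  qed
  have "inj_on (\<lambda>i. i mod q) {i. d i \<noteq> 0}"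
  proof (rule linorder_inj_onI)
    fix i j assume ij: "i < j" "i \<in> {i. d i \<noteq> 0}" "j \<in> {i. d i \<noteq> 0}"
    show "i mod q \<noteq> j mod q"
    proof
      assume "i mod q = j mod q"
      then obtain k where k: "j = i + k * q" "k > 0"
        using ij(1) by (metis add.commute less_imp_le_nat mod_eq_nat1E mult.commute mult_0_right
            add_0_right less_irrefl neq0_conv)
      have s: "(\<Sum>l<Suc k. d (i + l * q)) = d i + (\<Sum>l\<in>{1..<k}. d (i + l * q)) + d j"
        using k by (simp add: lessThan_atLeast0 sum.atLeast_Suc_lessThan)
      have "\<bar>\<Sum>l<Suc k. d (i + l * q)\<bar> \<ge> 2"
      proof (cases "d i > 0")
        case True
        hence nn: "d l \<ge> 0" for l using dd[of i l] by linarith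
        have "(\<Sum>l\<in>{1..<k}. d (i + l * q)) \<ge> 0" by (rule sum_nonneg) (use nn in auto)
        thus ?thesis unfolding s using True ij(3) nn[of j] by auto
      next
        case False
        hence "d i < 0" using ij by auto
        hence nn: "d l \<le> 0" for l using dd[of l i] by linarith
        have "(\<Sum>l\<in>{1..<k}. d (i + l * q)) \<le> 0" by (rule sum_nonpos) (use nn in auto)
        thus ?thesis unfolding s using \<open>d i < 0\<close> ij(3) nn[of j] by auto
      qed
      thus False using tel1[of i "Suc k"] by linarith
    qed
  qed auto
  moreover have "finite ((\<lambda>i. i mod q) ` {i. d i \<noteq> 0})"
    by (rule finite_subset[of _ "{..<q}"]) (use q in auto)
  ultimately have "finite {i. d i \<noteq> 0}" using finite_image_iff by blast
  then obtain K where "\<forall>i\<in>{i. d i \<noteq> 0}. i < K" using finite_nat_set_iff_bounded by blast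
  hence "\<forall>i\<ge>K. d i = 0" by (meson leD mem_Collect_eq)
  thus ?thesis unfolding d_def by (intro exI[of _ K]) auto
qed

lemma cnt_cong: "(\<And>j. w j \<in> S \<longleftrightarrow> w j \<in> T) \<Longrightarrow> cnt S w i = cnt T w i"
  by (simp add: cnt_def)

lemma bounded_discrepancyD:
  assumes "bounded_discrepancy c \<rho> x"
  shows "\<bar>(real (c j) - real j * \<rho>) - (real (c i) - real i * \<rho>)\<bar> \<le> 1"
  using assms unfolding bounded_discrepancy_def by (smt (verit))

lemma bounded_discrepancy_unbounded:
  assumes "bounded_discrepancy c \<rho> x" "\<rho> > 0"
  shows "\<exists>i. c i > n"
proof -
  obtain i :: nat where "real i * \<rho> > real n + 1 - x" using reals_Archimedean3[OF assms(2)] by blast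
  moreover have "x - 1 \<le> real (c i) - real i * \<rho>" using assms(1) by (auto simp: bounded_discrepancy_def)
  ultimately have "real (c i) > real n" by linarith
  thus ?thesis by auto
qed

text \<open>For a rational frequency the discrepancy bound still permits one jump in a residue class of
  positions; the last assumption excludes it.\<close>

locale frequencies =
  fixes w :: "'a word" and \<rho> x :: "'a \<Rightarrow> real"
  assumes fin: "finite (range w)"
    and pos: "a \<in> range w \<Longrightarrow> \<rho> a > 0"
    and disc: "a \<in> range w \<Longrightarrow> bounded_discrepancy (cnt {a} w) (\<rho> a) (x a)"
    and rat: "a \<in> range w \<Longrightarrow> \<rho> a \<in> \<rat> \<Longrightarrow>
      \<exists>q>0. \<exists>p. real q * \<rho> a = of_int p \<and> (\<forall>i. int (cnt {a} w (i + q)) = int (cnt {a} w i) + p)"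

lemma bounded_discrepancy_shift:
  assumes "bounded_discrepancy (cnt S v) \<rho> x"
  shows "bounded_discrepancy (cnt S (\<lambda>n. v (k + n))) \<rho> (x - (real (cnt S v k) - real k * \<rho>))"
  unfolding bounded_discrepancy_def
proof
  fix i
  have "x - 1 \<le> real (cnt S v (k + i)) - real (k + i) * \<rho> \<and> real (cnt S v (k + i)) - real (k + i) * \<rho> \<le> x"
    using assms unfolding bounded_discrepancy_def by blast
  thus "x - (real (cnt S v k) - real k * \<rho>) - 1 \<le> real (cnt S (\<lambda>n. v (k + n)) i) - real i * \<rho> \<and>
     real (cnt S (\<lambda>n. v (k + n)) i) - real i * \<rho> \<le> x - (real (cnt S v k) - real k * \<rho>)"
    unfolding cnt_shift[of S v k i] by (simp add: algebra_simps)
qed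

text \<open>Finitely many letters are involved, so some tail starts after all jumps of letters with
  rational frequency. A letter of frequency 0 gains nothing over a period there and hence does not
  occur in the tail.\<close>

lemma balanced_imp_frequencies:
  assumes bal: "balanced v" and fin: "finite (range v)"
  shows "\<exists>k \<rho> x. frequencies (\<lambda>n. v (k + n)) \<rho> x"
proof -
  have "\<exists>\<rho> x. \<rho> \<ge> 0 \<and> bounded_discrepancy (cnt {a} v) \<rho> x" for a
    by (rule balanced_imp_bounded_discrepancy[OF cnt_mono balanced_cnt[OF bal]])
  then obtain \<rho> x where \<rho>: "\<And>a. \<rho> a \<ge> 0" "\<And>a. bounded_discrepancy (cnt {a} v) (\<rho> a) (x a)"
    by metis
  have "\<exists>q p K. \<rho> a \<in> \<rat> \<longrightarrow> q > 0 \<and> real q * \<rho> a = of_int p \<and>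
      (\<forall>i\<ge>K. int (cnt {a} v (i + q)) = int (cnt {a} v i) + p)" for a
  proof (cases "\<rho> a \<in> \<rat>")
    case True
    then obtain p :: int and q :: nat where "q \<noteq> 0" "\<rho> a = of_int p / of_nat q"
      by (auto simp: Rats_eq_int_div_nat)
    hence "q > 0" "real q * \<rho> a = of_int p" by auto
    with rational_frequency_eventually_periodic[OF balanced_cnt[OF bal] \<rho>(2)] show ?thesis by blast
  qed auto
  then obtain q p K where K: "\<And>a. \<rho> a \<in> \<rat> \<Longrightarrow> q a > 0 \<and> real (q a) * \<rho> a = of_int (p a) \<and>
      (\<forall>i\<ge>K a. int (cnt {a} v (i + q a)) = int (cnt {a} v i) + p a)" by metis
  define k where "k = Max (K ` range v)"
  have k: "K a \<le> k" if "a \<in> range v" for a unfolding k_def using fin that by (intro Max_ge) auto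
  let ?w = "\<lambda>n. v (k + n)"
  have per: "q a > 0 \<and> real (q a) * \<rho> a = of_int (p a) \<and>
      (\<forall>i. int (cnt {a} ?w (i + q a)) = int (cnt {a} ?w i) + p a)" if "a \<in> range v" "\<rho> a \<in> \<rat>" for a
  proof (intro conjI allI)
    fix i
    have "K a \<le> k + i" using k[OF that(1)] by simp
    hence "int (cnt {a} v (k + i + q a)) = int (cnt {a} v (k + i)) + p a" using K[OF that(2)] by blast
    thus "int (cnt {a} ?w (i + q a)) = int (cnt {a} ?w i) + p a"
      by (simp add: cnt_shift add.assoc)
  qed (use K[OF that(2)] in auto)
  have "frequencies ?w \<rho> (\<lambda>a. x a - (real (cnt {a} v k) - real k * \<rho> a))"
  proof
    show "finite (range ?w)" using fin by (rule finite_subset[rotated]) auto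
    show "bounded_discrepancy (cnt {a} ?w) (\<rho> a) (x a - (real (cnt {a} v k) - real k * \<rho> a))" for a
      by (rule bounded_discrepancy_shift[OF \<rho>(2)])
    show "\<exists>q>0. \<exists>p. real q * \<rho> a = of_int p \<and> (\<forall>i. int (cnt {a} ?w (i + q)) = int (cnt {a} ?w i) + p)"
      if "a \<in> range ?w" "\<rho> a \<in> \<rat>" for a
      using per[of a] that by auto
    show "\<rho> a > 0" if a: "a \<in> range ?w" for a
    proof (rule ccontr)
      assume "\<not> \<rho> a > 0"
      hence 0: "\<rho> a = 0" using \<rho>(1)[of a] by linarith
      hence p: "q a > 0" "p a = 0" "int (cnt {a} ?w (i + q a)) = int (cnt {a} ?w i)" for i
        using per[of a] a by auto
      obtain i where i: "?w i = a" using a by auto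
      have "cnt {a} ?w (Suc i) \<le> cnt {a} ?w (i + q a)" using p(1) by (intro cnt_mono) auto
      thus False using p(3)[of i] i by (simp add: cnt_Suc)
    qed
  qed
  thus ?thesis by blast
qed

text \<open>The two subwords are later extracted from the tail without the first letter, so the
  locale has to survive a shift with the same \<open>\<rho>\<close>.\<close>

lemma (in frequencies) frequencies_shift: "\<exists>x'. frequencies (\<lambda>n. w (k + n)) \<rho> x'"
proof -
  let ?w = "\<lambda>n. w (k + n)"
  have sub: "range ?w \<subseteq> range w" by auto
  have "frequencies ?w \<rho> (\<lambda>a. x a - (real (cnt {a} w k) - real k * \<rho> a))"
  proof
    show "finite (range ?w)" using fin sub by (rule finite_subset[rotated])
    fix a assume "a \<in> range ?w"
    hence a: "a \<in> range w" using sub by blast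
    show "\<rho> a > 0" by (rule pos[OF a])
    show "bounded_discrepancy (cnt {a} ?w) (\<rho> a) (x a - (real (cnt {a} w k) - real k * \<rho> a))"
      by (rule bounded_discrepancy_shift[OF disc[OF a]])
    assume "\<rho> a \<in> \<rat>"
    then obtain q p where q: "q > 0" "real q * \<rho> a = of_int p" 
      and p: "\<And>i. int (cnt {a} w (i + q)) = int (cnt {a} w i) + p" using rat[OF a] by blast
    have "int (cnt {a} ?w (i + q)) = int (cnt {a} ?w i) + p" for i
      using p[of "k + i"] cnt_shift[of "{a}" w k i] cnt_shift[of "{a}" w k "i + q"] by (simp add: add.assoc)
    thus "\<exists>q>0. \<exists>p. real q * \<rho> a = of_int p \<and> (\<forall>i. int (cnt {a} ?w (i + q)) = int (cnt {a} ?w i) + p)"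
      using q by blast
  qed
  thus ?thesis by blast
qed

lemma add_period:
  fixes c :: "nat \<Rightarrow> nat"
  assumes "\<And>i. int (c (i + q)) = int (c i) + p"
  shows "int (c (i + k * q)) = int (c i) + int k * p"
proof (induction k)
  case (Suc k)
  have "i + Suc k * q = (i + k * q) + q" by simp
  thus ?case using Suc assms[of "i + k * q"] by (simp add: algebra_simps)
qed simp

section \<open>Common periods and simultaneous approximation\<close>

context frequencies
begin

lemma sum_cnt: "(\<Sum>a\<in>range w. cnt {a} w i) = i"
proof -
  have "cnt (range w) w i = i" by (induction i) (auto simp: cnt_Suc)
  thus ?thesis using cnt_eq_sum[OF fin] by metis
qed

text \<open>The discrepancies of all letters add up to \<open>i * (1 - ?s)\<close>, which stays
  bounded in \<open>i\<close> only if the frequencies sum to 1.\<close>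

lemma sum_freq: "(\<Sum>a\<in>range w. \<rho> a) = 1"
proof (rule ccontr)
  let ?s = "\<Sum>a\<in>range w. \<rho> a"
  assume ne: "?s \<noteq> 1"
  define N where "N = (\<Sum>a\<in>range w. \<bar>x a\<bar> + 1)"
  have b: "\<bar>real i * (1 - ?s)\<bar> \<le> N" for i
  proof -
    have "real i * (1 - ?s) = (\<Sum>a\<in>range w. real (cnt {a} w i) - real i * \<rho> a)"
      using arg_cong[OF sum_cnt[of i], of real] by (simp add: sum_subtractf sum_distrib_left algebra_simps)
    also have "\<bar>\<dots>\<bar> \<le> N" unfolding N_def
    proof (rule order_trans[OF sum_abs], rule sum_mono)
      fix a assume "a \<in> range w"
      from disc[OF this] show "\<bar>real (cnt {a} w i) - real i * \<rho> a\<bar> \<le> \<bar>x a\<bar> + 1"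
        unfolding bounded_discrepancy_def by (smt (verit))
    qed
    finally show ?thesis .
  qed
  obtain i :: nat where "real i * \<bar>1 - ?s\<bar> > N" using reals_Archimedean3[of "\<bar>1 - ?s\<bar>"] ne by auto
  thus False using b[of i] by (simp add: abs_mult)
qed

lemma cnt_unbounded:
  assumes "a \<in> S" "a \<in> range w"
  shows "\<exists>i. cnt S w i > n"
proof -
  obtain i where i: "cnt {a} w i > n"
    using bounded_discrepancy_unbounded[OF disc[OF assms(2)] pos[OF assms(2)]] by blast
  have "cnt {a} w i \<le> cnt S w i" unfolding cnt_def using assms(1) by (intro card_mono) auto
  thus ?thesis using i by (intro exI[of _ i]) linarith
qed

lemma common_rational_period:
  "\<exists>Q>0. \<forall>a\<in>range w. \<rho> a \<in> \<rat> \<longrightarrow>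
     (\<exists>p. real Q * \<rho> a = of_int p \<and> (\<forall>i. int (cnt {a} w (i + Q)) = int (cnt {a} w i) + p))"
proof -
  obtain q p where qp: "\<And>a. a \<in> range w \<Longrightarrow> \<rho> a \<in> \<rat> \<Longrightarrow>
      q a > (0::nat) \<and> real (q a) * \<rho> a = of_int (p a) \<and> (\<forall>i. int (cnt {a} w (i + q a)) = int (cnt {a} w i) + p a)"
    using rat by metis
  define Q where "Q = (\<Prod>a\<in>{a\<in>range w. \<rho> a \<in> \<rat>}. q a)"
  have finr: "finite {a\<in>range w. \<rho> a \<in> \<rat>}" using fin by auto
  have "Q > 0" unfolding Q_def by (rule prod_pos) (use qp in auto)
  moreover have "\<exists>p. real Q * \<rho> a = of_int p \<and> (\<forall>i. int (cnt {a} w (i + Q)) = int (cnt {a} w i) + p)"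
    if a: "a \<in> range w" "\<rho> a \<in> \<rat>" for a
  proof -
    have "q a dvd Q" unfolding Q_def using finr a by (intro dvd_prodI) auto
    then obtain k where k: "Q = k * q a" by (metis dvdE mult.commute)
    have "int (cnt {a} w (i + Q)) = int (cnt {a} w i) + int k * p a" for i
      unfolding k by (rule add_period) (use qp[OF a] in blast)
    moreover have "real Q * \<rho> a = of_int (int k * p a)" using qp[OF a] by (simp add: k)
    ultimately show ?thesis by blast
  qed
  ultimately show ?thesis by blast
qed

text \<open>A window of length \<open>Q\<close> contains each letter equally often wherever it
  starts; sliding it by one place forces the entering letter to equal the leaving one.\<close>

lemma rational_imp_periodic:
  assumes "\<And>a. a \<in> range w \<Longrightarrow> \<rho> a \<in> \<rat>"
  shows "\<exists>t>0. \<forall>i. w (i + t) = w i"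
proof -
  obtain Q where Q: "Q > 0" "\<And>a. a \<in> range w \<Longrightarrow> \<rho> a \<in> \<rat> \<Longrightarrow>
     \<exists>p. real Q * \<rho> a = of_int p \<and> (\<forall>i. int (cnt {a} w (i + Q)) = int (cnt {a} w i) + p)"
    using common_rational_period by blast
  have "w (i + Q) = w i" for i
  proof -
    obtain p where p: "\<And>j. int (cnt {w i} w (j + Q)) = int (cnt {w i} w j) + p" using Q(2)[of "w i"] assms[of "w i"] by auto
    from p[of i] p[of "Suc i"] show ?thesis by (auto simp: cnt_Suc split: if_splits)
  qed
  thus ?thesis using Q(1) by blast
qed

text \<open>Dirichlet's theorem is applied to the numbers \<open>Q * \<rho> a\<close>, with
  \<open>Q\<close> a common period of the letters of rational frequency. Then \<open>t\<close> is a
  multiple of \<open>Q\<close>, and for those letters the approximation is exact.\<close>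

lemma simultaneous_approximation:
  assumes "\<eta> > 0"
  shows "\<exists>t>0. \<exists>m. \<forall>a\<in>range w. \<bar>real t * \<rho> a - of_int (m a)\<bar> < \<eta> \<and>
     (\<rho> a \<in> \<rat> \<longrightarrow> real t * \<rho> a = of_int (m a) \<and> (\<forall>i. int (cnt {a} w (i + t)) = int (cnt {a} w i) + m a))"
proof -
  obtain Q where Q: "Q > 0" "\<And>a. a \<in> range w \<Longrightarrow> \<rho> a \<in> \<rat> \<Longrightarrow>
     \<exists>p. real Q * \<rho> a = of_int p \<and> (\<forall>i. int (cnt {a} w (i + Q)) = int (cnt {a} w i) + p)"
    using common_rational_period by blast
  obtain h where h: "bij_betw h {0..<card (range w)} (range w)" using ex_bij_betw_nat_finite[OF fin] by blast
  obtain N0 :: nat where N0: "1 / \<eta> < real N0" using reals_Archimedean2 by blast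
  define N where "N = Suc N0"
  have N: "N > 0" "1 / real N < \<eta>" using N0 assms by (auto simp: N_def field_simps)
  have N1: "1 / real N \<le> 1" by (simp add: N_def)
  obtain s p where s: "0 < s" and sp: "\<And>i. i < card (range w) \<Longrightarrow> \<bar>of_int s * (real Q * \<rho> (h i)) - of_int (p i)\<bar> < 1 / N"
    using Dirichlet_approx_simult[OF N(1), of "card (range w)" "\<lambda>i. real Q * \<rho> (h i)"] by metis
  define m where "m a = p (inv_into {0..<card (range w)} h a)" for a
  define t where "t = nat s * Q"
  have m: "\<bar>real t * \<rho> a - of_int (m a)\<bar> < 1 / N" if "a \<in> range w" for a
  proof -
    let ?i = "inv_into {0..<card (range w)} h a"
    have "?i < card (range w)" "h ?i = a"
      using h that by (metis atLeastLessThan_iff bij_betw_imp_surj_on inv_into_into)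
        (use h that in \<open>metis bij_betw_inv_into_right\<close>)
    thus ?thesis using sp[of ?i] s by (simp add: t_def m_def mult.assoc)
  qed
  have "real t * \<rho> a = of_int (m a) \<and> (\<forall>i. int (cnt {a} w (i + t)) = int (cnt {a} w i) + m a)"
    if a: "a \<in> range w" "\<rho> a \<in> \<rat>" for a
  proof -
    obtain p' where p': "real Q * \<rho> a = of_int p'" "\<And>i. int (cnt {a} w (i + Q)) = int (cnt {a} w i) + p'"
      using Q(2)[OF a] by blast
    have e: "real t * \<rho> a = of_int (s * p')" using p'(1) s by (simp add: t_def mult.assoc)
    hence "\<bar>real_of_int (s * p' - m a)\<bar> < 1" using m[OF a(1)] N1 by simp
    hence "s * p' = m a" by linarith
    moreover have "int (cnt {a} w (i + t)) = int (cnt {a} w i) + int (nat s) * p'" for i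
      unfolding t_def by (rule add_period) (rule p'(2))
    ultimately show ?thesis using e s by simp
  qed
  moreover have "t > 0" using s Q(1) by (simp add: t_def)
  moreover have "\<bar>real t * \<rho> a - of_int (m a)\<bar> < \<eta>" if "a \<in> range w" for a
    using m[OF that] N(2) by linarith
  ultimately show ?thesis by (intro exI[of _ t] conjI exI[of _ m]) blast+
qed

end

section \<open>Splitting a balanced word into two periodic subwords\<close>

text \<open>A merge of \<open>y\<close> and \<open>z\<close> in which membership in \<open>A\<close>
  tells which of the two advances. The range conditions keep letters that do not occur in
  \<open>w\<close> out of \<open>y\<close> and \<open>z\<close>.\<close>

definition interleaves :: "'a word \<Rightarrow> 'a set \<Rightarrow> 'a word \<Rightarrow> 'a word \<Rightarrow> bool" where
  "interleaves w A y z \<longleftrightarrow> (\<forall>i. w i = (if w i \<in> A then y (cnt A w i) else z (cnt (- A) w i))) \<and>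
     range y = range w \<inter> A \<and> range z = range w - A"

text \<open>An occurrence of \<open>S\<close> is determined by its index, so the repetition supplied
  by \<open>rep\<close> is the occurrence whose index is larger by \<open>m\<close>.\<close>

lemma subword_periodic:
  assumes unb: "\<And>n. \<exists>i. cnt S w i > n"
    and rep: "\<And>i. w i \<in> S \<Longrightarrow> \<exists>j. w j = w i \<and> cnt S w j = cnt S w i + m"
  shows "\<exists>y. (\<forall>i. w i \<in> S \<longrightarrow> y (cnt S w i) = w i) \<and> (\<forall>n. y (n + m) = y n) \<and> range y = range w \<inter> S"
proof -
  have "\<exists>i. w i \<in> S \<and> cnt S w i = n" for n
    using unb[of n] cnt_crossing[of n S w] by blast
  then obtain i where i: "\<And>n. w (i n) \<in> S" "\<And>n. cnt S w (i n) = n" by metis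
  define y where "y n = w (i n)" for n
  have y: "y (cnt S w j) = w j" if "w j \<in> S" for j
  proof -
    have "i (cnt S w j) = j" by (rule cnt_eq_imp_eq[OF i(1) that]) (rule i(2))
    thus ?thesis by (simp add: y_def)
  qed
  have "y (n + m) = y n" for n
  proof -
    obtain j where "w j = w (i n)" "cnt S w j = n + m" using rep[OF i(1)[of n]] i(2) by auto
    thus ?thesis using y[of j] i(1) by (simp add: y_def)
  qed
  moreover have "range y = range w \<inter> S"
  proof
    show "range y \<subseteq> range w \<inter> S" using i(1) by (auto simp: y_def)
    show "range w \<inter> S \<subseteq> range y"
    proof
      fix a assume "a \<in> range w \<inter> S"
      then obtain j where "a = w j" "w j \<in> S" by auto
      thus "a \<in> range y" using y[of j] by (metis rangeI)
    qed
  qed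
  ultimately show ?thesis using y by blast
qed

text \<open>The surplus \<open>d a i\<close> of a window of length \<open>t\<close> over
  \<open>m a\<close> is 0 or 1 on \<open>A\<close>, 0 or -1 on \<open>B\<close>, and the surpluses
  at \<open>i\<close> cancel. A nonzero one means that \<open>w (i - 1)\<close> in \<open>B\<close>
  and \<open>w i\<close> in \<open>A\<close> appear exchanged at distance \<open>t\<close>.
  Exchanges do not overlap, so the order within \<open>A\<close> and the order within
  \<open>B\<close> repeat. The first letter is dropped because an exchange refers to a
  predecessor.\<close>

lemma (in frequencies) exists_interleaving:
  assumes a0: "a0 \<in> range w" "\<rho> a0 \<notin> \<rat>"
  shows "\<exists>A y z P Q. interleaves (\<lambda>n. w (1 + n)) A y z \<and> P > 0 \<and> Q > 0 \<and>
     (\<forall>n. y (n + P) = y n) \<and> (\<forall>n. z (n + Q) = z n) \<and> (\<exists>a\<in>range y. \<rho> a \<notin> \<rat>)"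
proof -
  have lt1: "\<rho> a < 1" if a: "a \<in> range w" for a
  proof -
    have "range w \<noteq> {a}"
    proof
      assume "range w = {a}"
      thus False using sum_freq a0 by simp
    qed
    then obtain b where b: "b \<in> range w" "b \<noteq> a" using a by blast
    have "\<rho> a + \<rho> b \<le> (\<Sum>a\<in>range w. \<rho> a)"
      using sum_mono2[OF fin, of "{a, b}" \<rho>] a b pos by (auto simp: less_imp_le)
    thus ?thesis using pos[OF b(1)] sum_freq by linarith
  qed
  \<comment> \<open>With errors below \<open>\<rho> a\<close> and \<open>1 - \<rho> a\<close>, one
    more step past an extreme position breaks the discrepancy bound. The third bound keeps the sum
    of the errors below 1, so the integers \<open>m a\<close> add up to exactly
    \<open>t\<close>.\<close>
  define \<eta> where "\<eta> = Min ((\<lambda>a. min (\<rho> a) (1 - \<rho> a)) ` range w \<union> {1 / (card (range w) + 1)})"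
  have "\<eta> > 0" unfolding \<eta>_def using fin pos lt1 by (subst Min_gr_iff) auto
  have \<eta>: "\<eta> \<le> \<rho> a" "\<eta> \<le> 1 - \<rho> a" if "a \<in> range w" for a
  proof -
    have "\<eta> \<le> min (\<rho> a) (1 - \<rho> a)" unfolding \<eta>_def by (rule Min_le) (use fin that in auto)
    thus "\<eta> \<le> \<rho> a" "\<eta> \<le> 1 - \<rho> a" by auto
  qed
  have \<eta>c: "\<eta> \<le> 1 / (card (range w) + 1)" unfolding \<eta>_def by (rule Min_le) (use fin in auto)
  obtain t m where t: "t > 0" and m0: "\<And>a. a \<in> range w \<Longrightarrow> \<bar>real t * \<rho> a - of_int (m a)\<bar> < \<eta>"
    and mrat: "\<And>a. a \<in> range w \<Longrightarrow> \<rho> a \<in> \<rat> \<Longrightarrow> real t * \<rho> a = of_int (m a) \<and> 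
      (\<forall>i. int (cnt {a} w (i + t)) = int (cnt {a} w i) + m a)"
    using simultaneous_approximation[OF \<open>\<eta> > 0\<close>] by blast
  define \<epsilon> where "\<epsilon> a = real t * \<rho> a - of_int (m a)" for a
  define c where "c a i = int (cnt {a} w i)" for a i
  define d where "d a i = c a (i + t) - c a i - m a" for a i
  define \<delta> where "\<delta> a i = real_of_int (c a i) - real i * \<rho> a" for a i
  have \<delta>: "\<bar>\<delta> a j - \<delta> a i\<bar> \<le> 1" if "a \<in> range w" for a i j
    unfolding \<delta>_def c_def using bounded_discrepancyD[OF disc[OF that]] by simp
  have \<delta>S: "\<delta> a (Suc i) = \<delta> a i - \<rho> a + (if w i = a then 1 else 0)" for a i
    by (simp add: \<delta>_def c_def cnt_Suc algebra_simps)
  have d\<delta>: "real_of_int (d a i) = \<delta> a (i + t) - \<delta> a i + \<epsilon> a" for a i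
    by (simp add: d_def \<delta>_def \<epsilon>_def algebra_simps)
  have \<epsilon>: "\<bar>\<epsilon> a\<bar> < \<rho> a" "\<bar>\<epsilon> a\<bar> < 1 - \<rho> a" "\<bar>\<epsilon> a\<bar> < 1 / (card (range w) + 1)" if "a \<in> range w" for a
    using m0[OF that] \<eta>[OF that] \<eta>c by (auto simp: \<epsilon>_def)
  have \<epsilon>rat: "\<epsilon> a = 0 \<longleftrightarrow> \<rho> a \<in> \<rat>" if "a \<in> range w" for a
  proof
    assume "\<epsilon> a = 0"
    hence "\<rho> a = of_int (m a) / of_nat t" using t by (simp add: \<epsilon>_def field_simps)
    thus "\<rho> a \<in> \<rat>" by simp
  qed (use mrat[OF that] in \<open>simp add: \<epsilon>_def\<close>)
  have drat: "d a i = 0" if "a \<in> range w" "\<epsilon> a = 0" for a i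
    using mrat[OF that(1)] \<epsilon>rat[OF that(1)] that(2) by (simp add: d_def c_def)
  have summ: "(\<Sum>a\<in>range w. m a) = int t"
  proof -
    have e: "(\<Sum>a\<in>range w. \<epsilon> a) = real t - of_int (\<Sum>a\<in>range w. m a)"
      using sum_freq by (simp add: \<epsilon>_def sum_subtractf flip: sum_distrib_left)
    have "\<bar>\<Sum>a\<in>range w. \<epsilon> a\<bar> \<le> (\<Sum>a\<in>range w. 1 / (card (range w) + 1))"
      by (rule order_trans[OF sum_abs], rule sum_mono) (use \<epsilon>(3) in \<open>auto simp: less_imp_le\<close>)
    also have "\<dots> < 1" by (simp add: field_simps)
    finally have "\<bar>real_of_int (int t - (\<Sum>a\<in>range w. m a))\<bar> < 1" unfolding e by simp
    thus ?thesis by linarith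
  qed
  have sum\<epsilon>: "(\<Sum>a\<in>range w. \<epsilon> a) = 0"
    using sum_freq summ by (simp add: \<epsilon>_def sum_subtractf flip: sum_distrib_left of_int_sum)
  have sumd: "(\<Sum>a\<in>range w. d a i) = 0" for i
  proof -
    have "(\<Sum>a\<in>range w. c a i) = int i" for i
      using arg_cong[OF sum_cnt[of i], of int] by (simp add: c_def)
    thus ?thesis using summ by (simp add: d_def sum_subtractf)
  qed
  define A where "A = {a\<in>range w. \<epsilon> a \<ge> 0}"
  define B where "B = {a\<in>range w. \<epsilon> a < 0}"
  have AB: "range w = A \<union> B" "A \<inter> B = {}" "finite A" "finite B" "A \<subseteq> range w" "B \<subseteq> range w"
    using fin by (auto simp: A_def B_def)
  have cntB: "cnt (- A) w i = cnt B w i" for i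
    by (rule cnt_cong) (use AB in auto)
  have dA: "d a i = 0 \<or> d a i = 1" if "a \<in> A" for a i
  proof (cases "\<epsilon> a = 0")
    case False
    hence "\<epsilon> a > 0" "a \<in> range w" using that by (auto simp: A_def)
    hence "real_of_int (d a i) > -1" "real_of_int (d a i) < 2"
      using \<delta>[of a "i + t" i] \<epsilon>[of a] lt1[of a] unfolding d\<delta> by linarith+
    thus ?thesis by linarith
  qed (use drat that in \<open>auto simp: A_def\<close>)
  have dB: "d a i = 0 \<or> d a i = -1" if "a \<in> B" for a i
  proof -
    have "\<epsilon> a < 0" "a \<in> range w" using that by (auto simp: B_def)
    hence "real_of_int (d a i) > -2" "real_of_int (d a i) < 1"
      using \<delta>[of a "i + t" i] \<epsilon>[of a] unfolding d\<delta> by linarith+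
    thus ?thesis by linarith
  qed
  \<comment> \<open>Where \<open>d a i\<close> is nonzero, the letter \<open>a\<close> trades places with a neighbour under the shift by \<open>t\<close>;
    a second simultaneous change would violate the discrepancy bound.\<close>
  have up: "w i = a \<and> w (i + t) \<noteq> a" "i \<ge> 1 \<Longrightarrow> w (i - 1) \<noteq> a \<and> w (i - 1 + t) = a"
    if "a \<in> A" "d a i = 1" for a i
  proof -
    have a: "a \<in> range w" and e: "\<delta> a (i + t) - \<delta> a i = 1 - \<epsilon> a"
      using that d\<delta>[of a i] by (auto simp: A_def)
    note E = \<epsilon>[OF a] pos[OF a] lt1[OF a]
    \<comment> \<open>In each of the four claims, the opposite letter would widen the difference
      \<open>1 - \<epsilon> a\<close> by \<open>\<rho> a\<close> or \<open>1 - \<rho> a\<close>,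
      both larger than the error, and push it beyond 1.\<close>
    have 1: "w i = a"
      using \<delta>S[of a i] \<delta>[OF a, of "i + t" "Suc i"] e E by (auto split: if_splits)
    have 2: "w (i + t) \<noteq> a"
      using \<delta>S[of a "i + t"] \<delta>[OF a, of "Suc (i + t)" i] e E by (auto split: if_splits)
    show "w i = a \<and> w (i + t) \<noteq> a" using 1 2 by blast
    assume "i \<ge> 1"
    then obtain l where l: "i = Suc l" by (cases i) auto
    have 3: "w l \<noteq> a"
      using \<delta>S[of a l] \<delta>[OF a, of "i + t" l] e E l by (auto split: if_splits)
    have 4: "w (l + t) = a"
      using \<delta>S[of a "l + t"] \<delta>[OF a, of "l + t" i] e E l by (auto split: if_splits)
    show "w (i - 1) \<noteq> a \<and> w (i - 1 + t) = a" using 3 4 l by simp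
  qed
  have down: "w i \<noteq> a \<and> w (i + t) = a" "i \<ge> 1 \<Longrightarrow> w (i - 1) = a \<and> w (i - 1 + t) \<noteq> a"
    if "a \<in> B" "d a i = -1" for a i
  proof -
    have a: "a \<in> range w" and e: "\<delta> a (i + t) - \<delta> a i = - 1 - \<epsilon> a"
      using that d\<delta>[of a i] by (auto simp: B_def)
    note E = \<epsilon>[OF a] pos[OF a] lt1[OF a]
    have 1: "w i \<noteq> a"
      using \<delta>S[of a i] \<delta>[OF a, of "i + t" "Suc i"] e E by (auto split: if_splits)
    have 2: "w (i + t) = a"
      using \<delta>S[of a "i + t"] \<delta>[OF a, of "Suc (i + t)" i] e E by (auto split: if_splits)
    show "w i \<noteq> a \<and> w (i + t) = a" using 1 2 by blast
    assume "i \<ge> 1"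
    then obtain l where l: "i = Suc l" by (cases i) auto
    have 3: "w l = a"
      using \<delta>S[of a l] \<delta>[OF a, of "i + t" l] e E l by (auto split: if_splits)
    have 4: "w (l + t) \<noteq> a"
      using \<delta>S[of a "l + t"] \<delta>[OF a, of "l + t" i] e E l by (auto split: if_splits)
    show "w (i - 1) = a \<and> w (i - 1 + t) \<noteq> a" using 3 4 l by simp
  qed
  have sumAB: "(\<Sum>a\<in>A. d a i) + (\<Sum>a\<in>B. d a i) = 0" for i
    using sumd[of i] AB by (simp add: sum.union_disjoint)
  \<comment> \<open>By \<open>up\<close>, a letter of \<open>A\<close> with surplus 1 at
    \<open>i\<close> must be \<open>w i\<close>, so there is at most one; the zero total then leaves
    -1 for \<open>B\<close>.\<close>
  have dichotomy: "(\<forall>a\<in>range w. d a i = 0) \<or>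
      ((\<exists>a\<in>A. d a i = 1) \<and> (\<exists>b\<in>B. d b i = -1) \<and> (\<Sum>a\<in>A. d a i) = 1 \<and> (\<Sum>a\<in>B. d a i) = -1)" for i
  proof (cases "\<exists>a\<in>A. d a i = 1")
    case True
    then obtain a where a: "a \<in> A" "d a i = 1" by blast
    have dd: "d a' i = (if a' = a then 1 else 0)" if "a' \<in> A" for a'
    proof (cases "d a' i = 1")
      case True
      hence "a' = a" using up(1)[OF a] up(1)[OF that] by blast
      thus ?thesis using a(2) by simp
    next
      case False
      thus ?thesis using dA[OF that, of i] a(2) by auto
    qed
    have "(\<Sum>a\<in>A. d a i) = (\<Sum>a'\<in>A. if a' = a then 1 else 0)" by (rule sum.cong[OF refl dd])
    also have "\<dots> = 1" using a AB(3) by simp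
    finally have 1: "(\<Sum>a\<in>A. d a i) = 1" .
    hence 2: "(\<Sum>a\<in>B. d a i) = -1" using sumAB[of i] by linarith
    have "\<exists>b\<in>B. d b i = -1"
    proof (rule ccontr)
      assume "\<not> ?thesis"
      hence "d b i = 0" if "b \<in> B" for b using dB[OF that, of i] that by auto
      thus False using 2 by simp
    qed
    thus ?thesis using True 1 2 by blast
  next
    case False
    have A0: "d a i = 0" if "a \<in> A" for a using dA[OF that, of i] False that by auto
    hence "(\<Sum>a\<in>B. - d a i) = 0" using sumAB[of i] by (simp add: sum_negf)
    moreover have "- d b i \<ge> 0" if "b \<in> B" for b using dB[OF that, of i] by linarith
    ultimately have "\<forall>b\<in>B. - d b i = 0" using AB(4) by (subst (asm) sum_nonneg_eq_0_iff) auto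
    thus ?thesis using A0 AB(1) by auto
  qed
  have cntS: "int (cnt S w (i + t)) = int (cnt S w i) + (\<Sum>a\<in>S. m a) + (\<Sum>a\<in>S. d a i)" if "finite S" for S i
    using cnt_eq_sum[OF that, of w] by (simp add: d_def c_def sum_subtractf sum.distrib algebra_simps)
  have mpos: "m a > 0" if "a \<in> range w" for a
  proof -
    have "real t * \<rho> a \<ge> 1 * \<rho> a" using t pos[OF that] by (intro mult_right_mono) auto
    hence "real_of_int (m a) > 0" using \<epsilon>(1)[OF that] unfolding \<epsilon>_def by linarith
    thus ?thesis by simp
  qed
  have \<epsilon>0: "\<epsilon> a0 \<noteq> 0" using \<epsilon>rat a0 by blast
  \<comment> \<open>The errors sum to 0 and that of \<open>a0\<close> is nonzero, so both signs
    occur. As \<open>a0\<close> may lie in \<open>B\<close>, the letter \<open>a1\<close> takes over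
    as the irrational letter of \<open>A\<close>.\<close>
  obtain a1 where a1: "a1 \<in> range w" "\<epsilon> a1 > 0"
  proof (rule ccontr)
    assume "\<not> thesis"
    hence "- \<epsilon> a \<ge> 0" if "a \<in> range w" for a using that \<open>\<And>a. a \<in> range w \<Longrightarrow> 0 < \<epsilon> a \<Longrightarrow> thesis\<close> by force
    hence "\<forall>a\<in>range w. - \<epsilon> a = 0" using sum\<epsilon> fin by (subst sum_nonneg_eq_0_iff[symmetric]) (auto simp: sum_negf)
    from bspec[OF this a0(1)] \<epsilon>0 show False by simp
  qed
  obtain b1 where b1: "b1 \<in> range w" "\<epsilon> b1 < 0"
  proof (rule ccontr)
    assume "\<not> thesis"
    hence "\<epsilon> a \<ge> 0" if "a \<in> range w" for a using that \<open>\<And>a. a \<in> range w \<Longrightarrow> \<epsilon> a < 0 \<Longrightarrow> thesis\<close> by force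
    hence "\<forall>a\<in>range w. \<epsilon> a = 0" using sum\<epsilon> fin by (subst sum_nonneg_eq_0_iff[symmetric]) auto
    from bspec[OF this a0(1)] \<epsilon>0 show False by simp
  qed
  define P where "P = nat (\<Sum>a\<in>A. m a)"
  define Q where "Q = nat (\<Sum>a\<in>B. m a)"
  have a1A: "a1 \<in> A" and b1B: "b1 \<in> B" using a1 b1 by (auto simp: A_def B_def)
  have PQ: "int P = (\<Sum>a\<in>A. m a)" "P > 0" "int Q = (\<Sum>a\<in>B. m a)" "Q > 0"
  proof -
    have "(\<Sum>a\<in>A. m a) > 0" using mpos AB a1A by (intro sum_pos) auto
    thus "int P = (\<Sum>a\<in>A. m a)" "P > 0" by (auto simp: P_def)
    have "(\<Sum>a\<in>B. m a) > 0" using mpos AB b1B by (intro sum_pos) auto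
    thus "int Q = (\<Sum>a\<in>B. m a)" "Q > 0" by (auto simp: Q_def)
  qed
  have same: "w (i + t) = w i" if "\<forall>a\<in>range w. d a i = 0" "\<forall>a\<in>range w. d a (Suc i) = 0" for i
    using that[rule_format, of "w i"] by (auto simp: d_def c_def cnt_Suc split: if_splits)
  \<comment> \<open>After an exchange at \<open>i\<close> the partner of \<open>w i\<close> comes
    one place early, at \<open>i - 1 + t\<close>. Otherwise there is no exchange at
    \<open>Suc i\<close> either, since it would put a letter of \<open>B\<close> at
    \<open>i\<close>, and the partner is at \<open>i + t\<close>.\<close>
  have repA: "\<exists>j\<ge>1. w j = w i \<and> cnt A w j = cnt A w i + P" if i: "i \<ge> 1" "w i \<in> A" for i
  proof (cases "\<forall>a\<in>range w. d a i = 0")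
    case False
    then obtain a b where ab: "a \<in> A" "d a i = 1" "b \<in> B" "d b i = -1" using dichotomy[of i] by blast
    have "w (i - 1) = b" "w (i - 1 + t) = a" "w i = a"
      using up[OF ab(1,2)] down[OF ab(3,4)] i by auto
    have "\<forall>a\<in>range w. d a (i - 1) = 0"
      using dichotomy[of "i - 1"] up(1)[of _ "i - 1"] \<open>w (i - 1) = b\<close> ab(3) AB(2) by blast
    hence "cnt A w (i - 1 + t) = cnt A w (i - 1) + P"
      using cntS[OF AB(3), of "i - 1"] PQ(1) AB(1) by (simp add: sum.neutral)
    moreover have "cnt A w i = cnt A w (i - 1)"
      using cnt_Suc[of A w "i - 1"] i \<open>w (i - 1) = b\<close> ab(3) AB(2) by auto
    ultimately show ?thesis using \<open>w (i - 1 + t) = a\<close> \<open>w i = a\<close> t i by (intro exI[of _ "i - 1 + t"]) auto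
  next
    case True
    have "\<forall>a\<in>range w. d a (Suc i) = 0"
      using dichotomy[of "Suc i"] down(2)[of _ "Suc i"] i AB(2) by auto
    from same[OF True this] have "w (i + t) = w i" .
    moreover have "cnt A w (i + t) = cnt A w i + P"
      using cntS[OF AB(3), of i] PQ(1) AB(1) True by (simp add: sum.neutral)
    ultimately show ?thesis using i by (intro exI[of _ "i + t"]) auto
  qed
  \<comment> \<open>Here an exchange at \<open>Suc i\<close> delays the partner to
    \<open>Suc i + t\<close>, and an exchange at \<open>i\<close> is impossible because it would put
    a letter of \<open>A\<close> there.\<close>
  have repB: "\<exists>j\<ge>1. w j = w i \<and> cnt B w j = cnt B w i + Q" if i: "i \<ge> 1" "w i \<in> B" for i
  proof (cases "\<forall>a\<in>range w. d a (Suc i) = 0")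
    case False
    then obtain a b where ab: "a \<in> A" "d a (Suc i) = 1" "b \<in> B" "d b (Suc i) = -1" 
      and s: "(\<Sum>a\<in>B. d a (Suc i)) = -1" using dichotomy[of "Suc i"] by blast
    have "w (Suc i + t) = b" "w i = b"
      using down[OF ab(3,4)] i by auto
    moreover have "int (cnt B w (Suc i + t)) = int (cnt B w i) + int Q"
      using cntS[OF AB(4), of "Suc i"] PQ(3) s i by (simp add: cnt_Suc)
    ultimately show ?thesis by (intro exI[of _ "Suc i + t"]) auto
  next
    case True
    have "\<forall>a\<in>range w. d a i = 0"
      using dichotomy[of i] up(1)[of _ i] i AB(2) by blast
    from same[OF this True] have "w (i + t) = w i" .
    moreover have "cnt B w (i + t) = cnt B w i + Q"
      using cntS[OF AB(4), of i] PQ(3) AB(1) \<open>\<forall>a\<in>range w. d a i = 0\<close> by (simp add: sum.neutral)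
    ultimately show ?thesis using i by (intro exI[of _ "i + t"]) auto
  qed
  let ?w = "\<lambda>n. w (1 + n)"
  have tail: "\<exists>y. (\<forall>i. ?w i \<in> S \<longrightarrow> y (cnt S ?w i) = ?w i) \<and> (\<forall>n. y (n + k) = y n) \<and> range y = range ?w \<inter> S"
    if rep: "\<And>i. i \<ge> 1 \<Longrightarrow> w i \<in> S \<Longrightarrow> \<exists>j\<ge>1. w j = w i \<and> cnt S w j = cnt S w i + k"
      and S: "s \<in> S" "s \<in> range w" for S k s
  proof (rule subword_periodic)
    fix n
    obtain i where i: "cnt S w i > n + 1" using cnt_unbounded[OF S] by blast
    have "cnt S w i \<le> cnt S w (1 + i)" by (rule cnt_mono) simp
    hence "cnt S w 1 + cnt S ?w i > n + 1" using i by (simp only: cnt_shift[of S w 1 i, symmetric])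
    moreover have "cnt S w 1 \<le> 1" by (rule cnt_compl)
    ultimately show "\<exists>i. cnt S ?w i > n" by (intro exI[of _ i]) linarith
  next
    fix i assume "?w i \<in> S"
    then obtain j where j: "j \<ge> 1" "w j = w (1 + i)" "cnt S w j = cnt S w (1 + i) + k" using rep[of "1 + i"] by auto
    from j(1) obtain l where "j = 1 + l" by (metis le_Suc_ex)
    thus "\<exists>j. ?w j = ?w i \<and> cnt S ?w j = cnt S ?w i + k"
      using j cnt_shift[of S w 1 i] cnt_shift[of S w 1 l] by (intro exI[of _ l]) simp
  qed
  obtain y where y: "\<And>i. ?w i \<in> A \<Longrightarrow> y (cnt A ?w i) = ?w i" "\<And>n. y (n + P) = y n" "range y = range ?w \<inter> A"
    using tail[OF repA a1A a1(1)] by blast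
  obtain z where z: "\<And>i. ?w i \<in> B \<Longrightarrow> z (cnt B ?w i) = ?w i" "\<And>n. z (n + Q) = z n" "range z = range ?w \<inter> B"
    using tail[OF repB b1B b1(1)] by blast
  have cntB': "cnt (- A) ?w i = cnt B ?w i" for i
    by (rule cnt_cong) (use AB in auto)
  have "interleaves ?w A y z"
    unfolding interleaves_def
  proof (intro conjI allI)
    fix i show "?w i = (if ?w i \<in> A then y (cnt A ?w i) else z (cnt (- A) ?w i))"
      using y(1)[of i] z(1)[of i] AB(1) unfolding cntB' by auto
  qed (use y z AB in auto)
  moreover have "a1 \<in> range y"
  proof -
    \<comment> \<open>The second occurrence of \<open>a1\<close> is not at position 0 and so
      survives the removal of the first letter.\<close>
    obtain i where "cnt {a1} w i > 1" using cnt_unbounded[of a1 "{a1}"] a1(1) by blast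
    then obtain j where "w j \<in> {a1}" "cnt {a1} w j = 1" using cnt_crossing by blast
    hence "w j = a1" "j \<noteq> 0" by (auto intro: gr0I)
    hence "a1 = ?w (j - 1)" by simp
    thus ?thesis using y(3) a1A by blast
  qed
  moreover have "\<rho> a1 \<notin> \<rat>" using \<epsilon>rat a1 by fastforce
  ultimately show ?thesis using PQ y(2) z(2) by blast
qed

section \<open>Constancy of the thresholds\<close>

text \<open>The coefficients must be nonnegative because they will count whole periods added to a
  lattice point. After scaling by \<open>\<gamma>\<close>, the target is lowered by
  \<open>K * \<theta>\<close> far enough to force the approximating integer \<open>h\<close> to be
  positive.\<close>

lemma dense_combinations:
  fixes \<beta> \<gamma> u v :: real
  assumes pos: "\<beta> > 0" "\<gamma> > 0" and irr: "\<beta> / \<gamma> \<notin> \<rat>" and uv: "u < v"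
  shows "\<exists>k l :: nat. u < real k * \<beta> - real l * \<gamma> \<and> real k * \<beta> - real l * \<gamma> < v"
proof -
  define \<theta> where "\<theta> = \<beta> / \<gamma>"
  define \<mu> where "\<mu> = (u + v) / (2 * \<gamma>)"
  define e where "e = (v - u) / (2 * \<gamma>)"
  have \<theta>: "\<theta> > 0" using pos by (simp add: \<theta>_def)
  have e: "e > 0" using uv pos by (simp add: e_def)
  obtain K :: nat where K: "real K * \<theta> > \<mu> + e" using reals_Archimedean3[OF \<theta>] by blast
  obtain h k where hk: "k > 0" "\<bar>of_int k * \<theta> - of_int h - (\<mu> - real K * \<theta>)\<bar> < e"
    using sequence_of_fractional_parts_is_dense[OF irr[folded \<theta>_def] e] by metis
  have "real_of_int k * \<theta> > 0" using hk(1) \<theta> by simp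
  hence "real_of_int h > 0" using hk(2) K by linarith
  hence h: "real (nat h) = of_int h" by simp
  define k' where "k' = nat k + K"
  have k': "real k' = of_int k + real K" using hk(1) by (simp add: k'_def)
  have "\<bar>real k' * \<theta> - real (nat h) - \<mu>\<bar> < e" using hk(2) unfolding k' h by (simp add: algebra_simps)
  hence "\<bar>real k' * \<theta> - real (nat h) - \<mu>\<bar> * \<gamma> < e * \<gamma>" using pos by simp
  moreover have "\<bar>real k' * \<theta> - real (nat h) - \<mu>\<bar> * \<gamma> = \<bar>(real k' * \<theta> - real (nat h) - \<mu>) * \<gamma>\<bar>"
    using pos by (simp add: abs_mult)
  moreover have "(real k' * \<theta> - real (nat h) - \<mu>) * \<gamma> = real k' * \<beta> - real (nat h) * \<gamma> - (u + v) / 2"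
    using pos by (simp add: \<theta>_def \<mu>_def field_simps)
  moreover have "e * \<gamma> = (v - u) / 2" using pos by (simp add: e_def)
  ultimately have "\<bar>real k' * \<beta> - real (nat h) * \<gamma> - (u + v) / 2\<bar> < (v - u) / 2" by simp
  hence "u < real k' * \<beta> - real (nat h) * \<gamma>" "real k' * \<beta> - real (nat h) * \<gamma> < v"
    by (auto simp: abs_less_iff field_simps)
  thus ?thesis by blast
qed

lemma periodic_add_mult:
  fixes y :: "nat \<Rightarrow> 'b"
  assumes "\<And>n. y (n + P) = y n"
  shows "y (n + k * P) = y n"
proof (induction k)
  case (Suc k)
  have "y (n + Suc k * P) = y ((n + k * P) + P)" by (simp add: algebra_simps)
  thus ?case using Suc assms by simp
qed simp

lemma cnt_periodic:
  assumes "\<And>n. y (n + P) = y n"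
  shows "cnt S y (n + k * P) = cnt S y n + k * cnt S y P"
proof -
  have "(\<lambda>n. y (P + n)) = y" using assms by (auto simp: add.commute)
  hence 1: "cnt S y (n + P) = cnt S y n + cnt S y P" for n
    using cnt_shift[of S y P n] by (simp add: add.commute)
  show ?thesis
  proof (induction k)
    case (Suc k)
    show ?case using Suc 1[of "n + k * P"] by (simp add: ac_simps)
  qed simp
qed

text \<open>Call \<open>cnt S w i - i * \<alpha>\<close> the height at \<open>i\<close>. With
  \<open>n = cnt S w i\<close>, the discrepancy of the next letter \<open>y n\<close> is an
  increasing affine function of the height. Its lower bound yields \<open>\<phi> n\<close>; its
  upper bound after reading that letter caps the height at \<open>\<phi> n + \<alpha>\<close>; a
  letter outside \<open>S\<close> lowers the height by \<open>\<alpha>\<close> and must not take it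
  below \<open>\<phi> n\<close>. If \<open>\<phi>\<close> is constant, the count of \<open>a\<close>
  is affine in the position along the occurrences of \<open>a\<close>.\<close>

lemma (in frequencies) subword_thresholds:
  assumes y: "\<forall>i. w i \<in> S \<longrightarrow> y (cnt S w i) = w i" "range y = range w \<inter> S"
    and P: "P > 0" "\<And>n. y (n + P) = y n"
  defines "\<alpha> \<equiv> \<Sum>a\<in>range y. \<rho> a"
  shows "\<alpha> > 0"
    and "a \<in> range y \<Longrightarrow> \<exists>f\<in>\<rat>. f > 0 \<and> \<rho> a = f * \<alpha>"
    and "\<exists>\<phi>. (\<forall>n. \<phi> (n + P) = \<phi> n) \<and>
      (\<forall>i. \<phi> (cnt S w i) \<le> real (cnt S w i) - real i * \<alpha>) \<and>
      (\<forall>i. w i \<in> S \<longrightarrow> real (cnt S w i) - real i * \<alpha> \<le> \<phi> (cnt S w i) + \<alpha>) \<and>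
      (\<forall>i. w i \<notin> S \<longrightarrow> real (cnt S w i) - real i * \<alpha> \<ge> \<phi> (cnt S w i) + \<alpha>) \<and>
      ((\<forall>n n'. \<phi> n = \<phi> n') \<longrightarrow> (\<forall>a\<in>range y. \<exists>f>0. \<forall>n n'. y n = a \<longrightarrow> y n' = a \<longrightarrow>
         real (cnt {a} y n) - real (cnt {a} y n') = f * (real n - real n')))"
proof -
  have fy: "finite (range y)" "range y \<subseteq> range w" using y(2) fin by auto
  have posy: "\<rho> a > 0" if "a \<in> range y" for a using that fy pos by auto
  have discy: "bounded_discrepancy (cnt {a} w) (\<rho> a) (x a)" if "a \<in> range y" for a using that fy disc by auto
  have ne: "range y \<noteq> {}" by simp
  show \<alpha>: "\<alpha> > 0" unfolding \<alpha>_def by (rule sum_pos[OF fy(1) ne posy])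
  have sub: "cnt {a} w i = cnt {a} y (cnt S w i)" if "a \<in> S" for a i
    using that y(1) by (induction i) (auto simp: cnt_Suc)
  have cS: "real (cnt S w i) = (\<Sum>a\<in>range y. real (cnt {a} w i))" for i
  proof -
    have "cnt S w i = cnt (range y) w i" using y(2) by (intro cnt_cong) auto
    thus ?thesis using cnt_eq_sum[OF fy(1)] by simp
  qed
  define N where "N = (\<Sum>a\<in>range y. \<bar>x a\<bar> + 1)"
  have b1: "\<bar>real (cnt {a} w i) - real i * \<rho> a\<bar> \<le> \<bar>x a\<bar> + 1" if "a \<in> range y" for a i
    using discy[OF that] unfolding bounded_discrepancy_def by (smt (verit))
  have b2: "\<bar>real (cnt S w i) - real i * \<alpha>\<bar> \<le> N" for i
  proof -
    have "real (cnt S w i) - real i * \<alpha> = (\<Sum>a\<in>range y. real (cnt {a} w i) - real i * \<rho> a)"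
      by (simp add: cS \<alpha>_def sum_subtractf sum_distrib_left)
    also have "\<bar>\<dots>\<bar> \<le> N" unfolding N_def by (rule order_trans[OF sum_abs], rule sum_mono) (rule b1)
    finally show ?thesis .
  qed
  have unb: "\<exists>i. cnt S w i > n" for n by (rule cnt_unbounded[of "y 0"]) (use y(2) in auto)
  define f where "f a = real (cnt {a} y P) / real P" for a
  have \<rho>f: "\<rho> a = f a * \<alpha>" if a: "a \<in> range y" for a
  proof (rule ccontr)
    assume "\<rho> a \<noteq> f a * \<alpha>"
    define p where "p = real (cnt {a} y P)"
    have ne: "\<bar>p * \<alpha> - real P * \<rho> a\<bar> > 0"
      using \<open>\<rho> a \<noteq> f a * \<alpha>\<close> P(1) by (simp add: f_def p_def field_simps)
    define M where "M = \<alpha> * (\<bar>x a\<bar> + 1) + \<rho> a * N"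
    obtain k :: nat where k: "real k * \<bar>p * \<alpha> - real P * \<rho> a\<bar> > M" using reals_Archimedean3[OF ne] by blast
    obtain i where i: "cnt S w i = 0 + k * P" using cnt_crossing unb[of "k * P"] by (metis add_0)
    have "a \<in> S" using a y(2) by auto
    hence "real (cnt {a} w i) = real k * p"
      unfolding sub[OF \<open>a \<in> S\<close>] i cnt_periodic[of y P, OF P(2)] by (simp add: p_def)
    moreover have "real (cnt S w i) = real k * real P" by (simp add: i)
    ultimately have e: "real k * (p * \<alpha> - real P * \<rho> a) =
       \<alpha> * (real (cnt {a} w i) - real i * \<rho> a) - \<rho> a * (real (cnt S w i) - real i * \<alpha>)"
      by (simp add: algebra_simps)
    have "\<bar>real k * (p * \<alpha> - real P * \<rho> a)\<bar> \<le>
       \<bar>\<alpha> * (real (cnt {a} w i) - real i * \<rho> a)\<bar> + \<bar>\<rho> a * (real (cnt S w i) - real i * \<alpha>)\<bar>"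
      unfolding e by (rule abs_triangle_ineq4)
    also have "\<dots> \<le> M" unfolding M_def using \<alpha> posy[OF a] b1[OF a, of i] b2[of i]
      by (simp only: abs_mult abs_of_pos) (intro add_mono mult_left_mono, auto)
    finally show False using k by (simp add: abs_mult)
  qed
  have fpos: "f a > 0" if "a \<in> range y" for a
    using \<rho>f[OF that] posy[OF that] \<alpha> by (simp add: zero_less_mult_iff)
  show "\<exists>f\<in>\<rat>. f > 0 \<and> \<rho> a = f * \<alpha>" if "a \<in> range y"
    using \<rho>f[OF that] fpos[OF that] by (intro bexI[of _ "f a"]) (auto simp: f_def)
  \<comment> \<open>The lower discrepancy bound of the next letter \<open>y n\<close>, solved for \<open>cnt S w i - i \<alpha>\<close>.\<close>
  define \<phi> where "\<phi> n = (x (y n) - 1 - real (cnt {y n} y n) + f (y n) * real n) / f (y n)" for n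
  have f\<phi>: "f (y n) * \<phi> n = x (y n) - 1 - real (cnt {y n} y n) + f (y n) * real n" for n
    using fpos[of "y n"] by (simp add: \<phi>_def)
  have \<phi>P: "\<phi> (n + P) = \<phi> n" for n
  proof -
    have "f (y n) * real P = real (cnt {y n} y P)" using P(1) by (simp add: f_def)
    thus ?thesis unfolding \<phi>_def P(2) using cnt_periodic[of y P, OF P(2), of "{y n}" n 1]
      by (simp add: algebra_simps)
  qed
  have ge: "x (y n) - 1 \<le> real (cnt {y n} w i) - real i * \<rho> (y n)" "real (cnt {y n} w i) - real i * \<rho> (y n) \<le> x (y n)"
    for n i using discy[of "y n"] unfolding bounded_discrepancy_def by auto
  have yS: "y n \<in> S" for n using y(2) by auto
  have \<theta>: "real (cnt {y n} w i) - real i * \<rho> (y n) = x (y n) - 1 + f (y n) * (real (cnt S w i) - real i * \<alpha> - \<phi> n)"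
    if "n = cnt S w i" for n i
    using f\<phi>[of n] \<rho>f[of "y n"] unfolding sub[OF yS] that by (simp add: algebra_simps)
  have low: "\<phi> (cnt S w i) \<le> real (cnt S w i) - real i * \<alpha>" for i
  proof -
    have "0 \<le> f (y (cnt S w i)) * (real (cnt S w i) - real i * \<alpha> - \<phi> (cnt S w i))"
      using ge(1)[of "cnt S w i" i] unfolding \<theta>[OF refl] by simp
    thus ?thesis using fpos[of "y (cnt S w i)"] by (simp add: zero_le_mult_iff)
  qed
  moreover have "real (cnt S w i) - real i * \<alpha> \<le> \<phi> (cnt S w i) + \<alpha>" if i: "w i \<in> S" for i
  proof -
    let ?n = "cnt S w i"
    have yi: "y ?n = w i" using y(1) i by blast
    have "real (cnt {y ?n} w (Suc i)) - real (Suc i) * \<rho> (y ?n) =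
        real (cnt {y ?n} w i) - real i * \<rho> (y ?n) + 1 - \<rho> (y ?n)"
      by (simp add: cnt_Suc yi algebra_simps)
    hence "x (y ?n) - 1 + f (y ?n) * (real ?n - real i * \<alpha> - \<phi> ?n) + 1 - \<rho> (y ?n) \<le> x (y ?n)"
      using ge(2)[of ?n "Suc i"] \<theta>[OF refl, of i] by linarith
    hence "f (y ?n) * (real ?n - real i * \<alpha> - \<phi> ?n) \<le> f (y ?n) * \<alpha>" using \<rho>f[of "y ?n"] by simp
    thus ?thesis using fpos[of "y ?n"] by simp
  qed
  moreover have "real (cnt S w i) - real i * \<alpha> \<ge> \<phi> (cnt S w i) + \<alpha>" if "w i \<notin> S" for i
    using low[of "Suc i"] that by (simp add: cnt_Suc algebra_simps)
  moreover have "\<exists>f>0. \<forall>n n'. y n = a \<longrightarrow> y n' = a \<longrightarrow>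
         real (cnt {a} y n) - real (cnt {a} y n') = f * (real n - real n')"
    if c: "\<forall>n n'. \<phi> n = \<phi> n'" and a: "a \<in> range y" for a
  proof (intro exI[of _ "f a"] conjI allI impI)
    fix n n' assume n: "y n = a" "y n' = a"
    have "\<phi> n = \<phi> n'" using c by blast
    thus "real (cnt {a} y n) - real (cnt {a} y n') = f a * (real n - real n')"
      using f\<phi>[of n] f\<phi>[of n'] unfolding n by (simp add: algebra_simps)
  qed (rule fpos[OF a])
  ultimately show "\<exists>\<phi>. (\<forall>n. \<phi> (n + P) = \<phi> n) \<and>
      (\<forall>i. \<phi> (cnt S w i) \<le> real (cnt S w i) - real i * \<alpha>) \<and>
      (\<forall>i. w i \<in> S \<longrightarrow> real (cnt S w i) - real i * \<alpha> \<le> \<phi> (cnt S w i) + \<alpha>) \<and>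
      (\<forall>i. w i \<notin> S \<longrightarrow> real (cnt S w i) - real i * \<alpha> \<ge> \<phi> (cnt S w i) + \<alpha>) \<and>
      ((\<forall>n n'. \<phi> n = \<phi> n') \<longrightarrow> (\<forall>a\<in>range y. \<exists>f>0. \<forall>n n'. y n = a \<longrightarrow> y n' = a \<longrightarrow>
         real (cnt {a} y n) - real (cnt {a} y n') = f * (real n - real n')))"
    using \<phi>P by (intro exI[of _ \<phi>]) blast
qed

text \<open>The lattice point \<open>(n, m)\<close> has height
  \<open>n - (n + m) * \<alpha>\<close>. Adding whole periods to the coordinates preserves both
  thresholds, while the heights reached are dense. Distinct thresholds would thus produce a point of
  the path at which neither kind of step is allowed.\<close>

lemma lattice_path_thresholds_constant:
  fixes \<phi> \<mu> :: "nat \<Rightarrow> real" and \<alpha> :: real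
  defines "\<theta> \<equiv> \<lambda>(w::'a word) A i. real (cnt A w i) - real i * \<alpha>"
  assumes \<alpha>: "0 < \<alpha>" "\<alpha> < 1" "\<alpha> \<notin> \<rat>" and P: "P > 0" "Q > 0" "\<And>n. \<phi> (n + P) = \<phi> n" "\<And>n. \<mu> (n + Q) = \<mu> n"
    and lo: "\<And>i. \<phi> (cnt A w i) \<le> \<theta> w A i" and hi: "\<And>i. \<theta> w A i \<le> \<mu> (cnt (- A) w i) + 1"
    and inA: "\<And>i. w i \<in> A \<Longrightarrow> \<theta> w A i \<le> \<phi> (cnt A w i) + \<alpha>" "\<And>i. w i \<in> A \<Longrightarrow> \<theta> w A i \<le> \<mu> (cnt (- A) w i) + \<alpha>"
    and outA: "\<And>i. w i \<notin> A \<Longrightarrow> \<theta> w A i \<ge> \<phi> (cnt A w i) + \<alpha>" "\<And>i. w i \<notin> A \<Longrightarrow> \<theta> w A i \<ge> \<mu> (cnt (- A) w i) + \<alpha>"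
    and unb: "\<And>n. \<exists>i. cnt A w i > n" "\<And>n. \<exists>i. cnt (- A) w i > n"
  shows "\<phi> n = \<mu> m"
proof -
  have dual: "cnt A w i + cnt (- A) w i = i" for i using cnt_compl[of A w i] by simp
  \<comment> \<open>A path missing \<open>(n, m)\<close> leaves column \<open>n\<close> by a step in
    \<open>A\<close>, or row \<open>m\<close> by a step outside \<open>A\<close>, before time
    \<open>n + m\<close>. The height at that step violates the bound for such steps.\<close>
  have on_path: "cnt A w (n + m) = n" 
    if r: "\<phi> n < real n - real (n + m) * \<alpha>" "real n - real (n + m) * \<alpha> < \<mu> m + 1" for n m
  proof (rule ccontr)
    assume ne: "cnt A w (n + m) \<noteq> n"
    show False
    proof (cases "cnt A w (n + m) > n")
      case True
      then obtain j where j: "j < n + m" "w j \<in> A" "cnt A w j = n" using cnt_crossing by blast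
      have "real j * \<alpha> + \<alpha> \<le> real (n + m) * \<alpha>"
        using j(1) \<alpha> mult_right_mono[of "real (Suc j)" "real (n + m)" \<alpha>] by (simp add: algebra_simps)
      thus False using inA(1)[OF j(2)] r(1) j(3) by (simp add: \<theta>_def)
    next
      case False
      hence "cnt (- A) w (n + m) > m" using ne dual[of "n + m"] by linarith
      then obtain j where j: "j < n + m" "w j \<in> - A" "cnt (- A) w j = m" using cnt_crossing by blast
      have c: "real (cnt A w j) = real j - real m" using dual[of j] j(3) by linarith
      have "real j * (1 - \<alpha>) + (1 - \<alpha>) \<le> real (n + m) * (1 - \<alpha>)"
        using j(1) \<alpha> mult_right_mono[of "real (Suc j)" "real (n + m)" "1 - \<alpha>"] by (simp add: algebra_simps)
      thus False using outA(2)[of j] j(2,3) r(2) c by (simp add: \<theta>_def algebra_simps)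
    qed
  qed
  \<comment> \<open>Adding \<open>P\<close> letters of \<open>A\<close> raises the height by
    \<open>P * (1 - \<alpha>)\<close>, adding \<open>Q\<close> other letters lowers it by
    \<open>Q * \<alpha>\<close>; irrationality of the ratio is what density requires.\<close>
  have irr: "(real P * (1 - \<alpha>)) / (real Q * \<alpha>) \<notin> \<rat>"
  proof
    assume "(real P * (1 - \<alpha>)) / (real Q * \<alpha>) \<in> \<rat>"
    from Rats_add[OF Rats_mult[OF this, of "real Q / real P"] Rats_1]
    have "(real P * (1 - \<alpha>)) / (real Q * \<alpha>) * (real Q / real P) + 1 \<in> \<rat>" by simp
    also have "(real P * (1 - \<alpha>)) / (real Q * \<alpha>) * (real Q / real P) + 1 = 1 / \<alpha>" using \<alpha> P by (simp add: field_simps)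
    finally have "1 / (1 / \<alpha>) \<in> \<rat>" by (rule Rats_divide[OF Rats_1])
    thus False using \<alpha> by simp
  qed
  \<comment> \<open>By density, the window between two distinct thresholds contains a point of the path,
    and neither kind of step is possible there.\<close>
  have no_gap: False if u: "max (\<phi> n) (min (\<phi> n) (\<mu> m) + \<alpha>) < min (\<mu> m + 1) (max (\<phi> n) (\<mu> m) + \<alpha>)" for n m
  proof -
    let ?u = "max (\<phi> n) (min (\<phi> n) (\<mu> m) + \<alpha>)" and ?v = "min (\<mu> m + 1) (max (\<phi> n) (\<mu> m) + \<alpha>)"
    let ?s = "real n * (1 - \<alpha>) - real m * \<alpha>"
    have "?u - ?s < ?v - ?s" using u by simp
    then obtain k l :: nat where kl: "?u - ?s < real k * (real P * (1 - \<alpha>)) - real l * (real Q * \<alpha>)" 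
       "real k * (real P * (1 - \<alpha>)) - real l * (real Q * \<alpha>) < ?v - ?s"
      using dense_combinations[OF _ _ irr] \<alpha> P by (metis diff_gt_0_iff_gt mult_pos_pos of_nat_0_less_iff)
    define n' where "n' = n + k * P"
    define m' where "m' = m + l * Q"
    have \<phi>': "\<phi> n' = \<phi> n" "\<mu> m' = \<mu> m" unfolding n'_def m'_def
      by (rule periodic_add_mult[of \<phi>, OF P(3)], rule periodic_add_mult[of \<mu>, OF P(4)])
    let ?t = "real n' - real (n' + m') * \<alpha>"
    have t: "?t = real k * (real P * (1 - \<alpha>)) - real l * (real Q * \<alpha>) + ?s"
      by (simp add: n'_def m'_def algebra_simps)
    have "?u < ?t" "?t < ?v" using kl unfolding t by linarith+
    note b = this[unfolded max_less_iff_conj min_less_iff_conj]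
    have c: "cnt A w (n' + m') = n'" by (rule on_path) (use b \<phi>' in auto)
    hence c': "cnt (- A) w (n' + m') = m'" using dual[of "n' + m'"] by simp
    have \<theta>t: "\<theta> w A (n' + m') = ?t" by (simp add: \<theta>_def c)
    show False
    proof (cases "w (n' + m') \<in> A")
      case True
      thus False using inA[OF True] b \<phi>' unfolding c c' \<theta>t by (auto simp: min_def split: if_splits)
    next
      case False
      thus False using outA[OF False] b \<phi>' unfolding c c' \<theta>t by (auto simp: max_def split: if_splits)
    qed
  qed
  have ge: "\<phi> n \<ge> \<mu> m" for n m
  proof (rule ccontr)
    assume "\<not> ?thesis"
    thus False by (intro no_gap[of n m]) (use \<alpha> in \<open>auto simp: min_def max_def\<close>)
  qed
  have le: "\<phi> n \<le> \<mu> m" if "\<phi> n < \<mu> m + 1" for n m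
  proof (rule ccontr)
    assume "\<not> ?thesis"
    thus False by (intro no_gap[of n m]) (use \<alpha> that in \<open>auto simp: min_def max_def\<close>)
  qed
  \<comment> \<open>Steps really taken out of column \<open>n\<close> and out of row
    \<open>m\<close> supply the side condition of \<open>le\<close>; together with \<open>ge\<close>
    the comparisons close into a cycle.\<close>
  obtain i where i: "w i \<in> A" "cnt A w i = n" using unb(1)[of n] cnt_crossing by blast
  have 1: "\<phi> n \<le> \<mu> (cnt (- A) w i)"
    by (rule le) (use lo[of i] inA(2)[OF i(1)] \<alpha> i(2) in simp)
  obtain j where j: "w j \<in> - A" "cnt (- A) w j = m" using unb(2)[of m] cnt_crossing by blast
  have 2: "\<phi> (cnt A w j) \<le> \<mu> m"
    by (rule le) (use hi[of j] outA(1)[of j] j \<alpha> in simp)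
  show ?thesis
    using 1 2 ge[of m n] ge[of "cnt (- A) w i" "cnt A w j"] by linarith
qed

section \<open>Exact covers by residue classes\<close>

text \<open>An exact cover of \<open>X\<close> by finitely many residue classes.\<close>

definition tiles :: "int set \<Rightarrow> 'i set \<Rightarrow> ('i \<Rightarrow> int) \<Rightarrow> ('i \<Rightarrow> int) \<Rightarrow> bool" where
  "tiles X I r g \<longleftrightarrow> finite I \<and> (\<forall>i\<in>I. g i > 0) \<and> (\<forall>n. n \<in> X \<longleftrightarrow> (\<exists>i\<in>I. g i dvd n - r i)) \<and>
     (\<forall>n. \<forall>i\<in>I. \<forall>j\<in>I. g i dvd n - r i \<longrightarrow> g j dvd n - r j \<longrightarrow> i = j)"

definition periodic_set :: "int \<Rightarrow> int set \<Rightarrow> bool" where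
  "periodic_set M X \<longleftrightarrow> M > 0 \<and> (\<forall>n n'. M dvd n - n' \<longrightarrow> n \<in> X \<longrightarrow> n' \<in> X)"

text \<open>Restricting an exact cover to one class modulo \<open>M\<close> keeps the tiles that
  meet it, and a nonempty intersection of two residue classes is a single class modulo the
  lcm.\<close>

lemma tiles_residue_class:
  assumes t: "tiles X I r g" and p: "periodic_set M X" and x: "x \<in> X"
  shows "\<exists>s. tiles {n. M dvd n - x} {i\<in>I. \<exists>n. g i dvd n - r i \<and> M dvd n - x} s (\<lambda>i. lcm (g i) M)"
proof -
  let ?J = "{i\<in>I. \<exists>n. g i dvd n - r i \<and> M dvd n - x}"
  define s where "s i = (SOME n. g i dvd n - r i \<and> M dvd n - x)" for i
  have s: "g i dvd s i - r i \<and> M dvd s i - x" if "i \<in> ?J" for i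
    unfolding s_def by (rule someI_ex) (use that in auto)
  have eq: "lcm (g i) M dvd n - s i \<longleftrightarrow> g i dvd n - r i \<and> M dvd n - x" if "i \<in> ?J" for i n
  proof -
    have "g i dvd n - s i \<longleftrightarrow> g i dvd n - r i" 
      using s[OF that] dvd_add_right_iff[of "g i" "s i - r i" "n - s i"] by (simp add: algebra_simps)
    moreover have "M dvd n - s i \<longleftrightarrow> M dvd n - x"
      using s[OF that] dvd_add_right_iff[of M "s i - x" "n - s i"] by (simp add: algebra_simps)
    ultimately show ?thesis by simp
  qed
  have "tiles {n. M dvd n - x} ?J s (\<lambda>i. lcm (g i) M)"
    unfolding tiles_def
  proof (intro conjI allI ballI impI)
    show "finite ?J" using t by (auto simp: tiles_def)
    show "lcm (g i) M > 0" if "i \<in> ?J" for i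
      using that t p by (auto simp: tiles_def periodic_set_def lcm_pos_int)
    show "n \<in> {n. M dvd n - x} \<longleftrightarrow> (\<exists>i\<in>?J. lcm (g i) M dvd n - s i)" for n
    proof
      assume n: "n \<in> {n. M dvd n - x}"
      hence "M dvd x - n" by (simp add: dvd_diff_commute)
      hence "n \<in> X" using p x by (auto simp: periodic_set_def)
      then obtain i where "i \<in> I" "g i dvd n - r i" using t by (auto simp: tiles_def)
      moreover from this n have "i \<in> ?J" by auto
      ultimately show "\<exists>i\<in>?J. lcm (g i) M dvd n - s i" using eq n by blast
    qed (use eq in blast)
    show "i = j" if "i \<in> ?J" "j \<in> ?J" "lcm (g i) M dvd n - s i" "lcm (g j) M dvd n - s j" for n i j
      using that eq t unfolding tiles_def by blast
  qed
  thus ?thesis by blast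
qed

lemma tiles_subset: "tiles X I r g \<Longrightarrow> J \<subseteq> I \<Longrightarrow> tiles {n. \<exists>i\<in>J. g i dvd n - r i} J r g"
  unfolding tiles_def by (elim conjE, intro conjI) (auto intro: finite_subset, blast)

lemma periodic_set_residue_class: "M > 0 \<Longrightarrow> periodic_set M {n. M dvd n - x}"
  unfolding periodic_set_def
proof (intro conjI allI impI)
  fix n n' assume "M dvd n - n'" "n \<in> {n. M dvd n - x}"
  thus "n' \<in> {n. M dvd n - x}"
    using dvd_diff[of M "n - x" "n - n'"] by simp
qed

lemma residue_class_nonempty: "{n. M dvd n - x} \<noteq> {}" for x :: int
  using dvd_0_right[of M] by (metis (mono_tags) diff_self empty_Collect_eq)

lemma dvd_shift: "(g::int) dvd L \<Longrightarrow> L dvd n - n' \<Longrightarrow> g dvd n - r \<longleftrightarrow> g dvd n' - r"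
  using dvd_add_right_iff[of g "n - n'" "n' - r"] dvd_trans[of g L "n - n'"] by simp

text \<open>Induction on the number of tiles. If some tile misses the class of \<open>x\<close>
  modulo \<open>M\<close>, the tiles meeting that class are treated first, and the others afterwards
  with the period so obtained in place of \<open>M\<close>. If all tiles meet the class, a prime
  dividing some \<open>lcm (g i) M div M\<close> splits it into smaller problems.\<close>

lemma tiles_common_period:
  assumes "tiles X I r g" "periodic_set M X" "X \<noteq> {}"
  shows "\<exists>L>0. L \<le> 2 ^ (card I - 1) * M \<and> M dvd L \<and> (\<forall>i\<in>I. g i dvd L)"
  using assms
proof (induction "card I" arbitrary: X I r g M rule: less_induct)
  case less
  note IH = less.hyps and tl = less.prems(1) and per = less.prems(2) and ne = less.prems(3)
  have M: "M > 0" using per by (simp add: periodic_set_def)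
  have fin: "finite I" using tl by (simp add: tiles_def)
  obtain x where x: "x \<in> X" using ne by auto
  define J where "J = {i\<in>I. \<exists>n. g i dvd n - r i \<and> M dvd n - x}"
  obtain s where ts: "tiles {n. M dvd n - x} J s (\<lambda>i. lcm (g i) M)"
    using tiles_residue_class[OF tl per x] unfolding J_def by blast
  have JI: "J \<subseteq> I" by (auto simp: J_def)
  have Jne: "J \<noteq> {}"
  proof -
    have "x \<in> {n. M dvd n - x}" by simp
    thus ?thesis using ts unfolding tiles_def by blast
  qed
  show ?case
  proof (cases "J = I")
    case False
    hence c: "card J < card I" using JI fin by (meson psubsetI psubset_card_mono)
    obtain L1 where L1: "L1 > 0" "L1 \<le> 2 ^ (card J - 1) * M" "M dvd L1" "\<forall>i\<in>J. lcm (g i) M dvd L1"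
      using IH[OF c ts periodic_set_residue_class[OF M] residue_class_nonempty] by blast
    define X2 where "X2 = {n. \<exists>i\<in>I - J. g i dvd n - r i}"
    have c2: "card (I - J) < card I" using Jne JI fin by (intro psubset_card_mono) auto
    have t2: "tiles X2 (I - J) r g" unfolding X2_def by (rule tiles_subset[OF tl]) auto
    \<comment> \<open>Being \<open>X\<close> without the tiles in \<open>J\<close>, the remainder
      inherits the period \<open>L1\<close>.\<close>
    have X2: "n \<in> X2 \<longleftrightarrow> n \<in> X \<and> \<not> (\<exists>i\<in>J. g i dvd n - r i)" for n
      using tl JI unfolding tiles_def X2_def by blast
    have "periodic_set L1 X2" unfolding periodic_set_def
    proof (intro conjI allI impI)
      fix n n' assume n: "L1 dvd n - n'" "n \<in> X2"
      have "M dvd n - n'" using n(1) L1(3) by (rule dvd_trans[rotated])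
      hence "n' \<in> X" using per n(2) X2 by (auto simp: periodic_set_def)
      moreover have "g i dvd n - r i \<longleftrightarrow> g i dvd n' - r i" if "i \<in> J" for i
        by (rule dvd_shift[OF _ n(1)]) (use L1(4) that lcm_least in auto)
      ultimately show "n' \<in> X2" using X2 n(2) by blast
    qed (rule L1)
    moreover have "X2 \<noteq> {}"
    proof -
      obtain i where "i \<in> I - J" using JI False by auto
      hence "r i \<in> X2" by (auto simp: X2_def intro!: bexI[of _ i])
      thus ?thesis by auto
    qed
    ultimately obtain L where L: "L > 0" "L \<le> 2 ^ (card (I - J) - 1) * L1" "L1 dvd L" "\<forall>i\<in>I - J. g i dvd L"
      using IH[OF c2 t2] by blast
    have cc: "card I = card J + card (I - J)" "card J > 0" "card (I - J) > 0"
    proof -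
      have "finite J" using JI fin by (rule finite_subset)
      thus "card I = card J + card (I - J)" using JI fin by (simp add: card_Diff_subset card_mono)
      show "card J > 0" using \<open>finite J\<close> Jne by (simp add: card_gt_0_iff)
      show "card (I - J) > 0" using fin JI False by (auto simp: card_gt_0_iff)
    qed
    have "L \<le> 2 ^ (card (I - J) - 1) * (2 ^ (card J - 1) * M)"
      by (rule order_trans[OF L(2)], rule mult_left_mono[OF L1(2)]) simp
    also have "\<dots> = 2 ^ ((card (I - J) - 1) + (card J - 1)) * M" by (simp add: power_add)
    also have "\<dots> \<le> 2 ^ (card I - 1) * M"
      using M cc by (intro mult_right_mono power_increasing) auto
    finally have "L \<le> 2 ^ (card I - 1) * M" .
    moreover have "g i dvd L" if "i \<in> I" for i
    proof (cases "i \<in> J")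
      case True
      hence "lcm (g i) M dvd L" using L1(4) L(3) by (blast intro: dvd_trans)
      thus ?thesis by (rule dvd_trans[OF dvd_lcm1])
    qed (use L(4) that in auto)
    moreover have "M dvd L" using L1(3) L(3) by (rule dvd_trans)
    ultimately show ?thesis using L(1) by blast
  next
    case True
    \<comment> \<open>Taking the lcm with \<open>M\<close> confines each tile to the class of
      \<open>x\<close>, and a common multiple of the \<open>h i\<close> also serves the
      \<open>g i\<close>.\<close>
    define h where "h i = lcm (g i) M" for i
    note ts = ts[unfolded True, folded h_def]
    have th: "tiles {n. M dvd n - x} I s h" using ts by (simp add: h_def[abs_def])
    have hpos: "h i > 0" if "i \<in> I" for i using th that by (auto simp: tiles_def)
    have Mh: "M dvd h i" for i by (simp add: h_def)
    have gh: "g i dvd h i" for i by (simp add: h_def)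
    have Ms: "M dvd s i - x" if "i \<in> I" for i using th that unfolding tiles_def by (metis diff_self dvd_0_right mem_Collect_eq)
    have cov: "\<exists>i\<in>I. h i dvd n - s i" if "M dvd n - x" for n
      using th that by (auto simp: tiles_def)
    have disj: "i = j" if "i \<in> I" "j \<in> I" "h i dvd n - s i" "h j dvd n - s j" for i j n
      using th that unfolding tiles_def by blast
    show ?thesis
    proof (cases "\<forall>i\<in>I. h i = M")
      case True
      have "M \<le> 2 ^ (card I - 1) * M" using M by simp
      moreover have "g i dvd M" if "i \<in> I" for i using gh[of i] True that by auto
      ultimately show ?thesis using M by (intro exI[of _ M]) auto
    next
      case False
      then obtain i1 where i1: "i1 \<in> I" "h i1 \<noteq> M" by auto
      define q where "q i = h i div M" for i
      have hq: "h i = q i * M" for i using Mh[of i] by (simp add: q_def)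
      have "q i1 > 0" "q i1 \<noteq> 1" using i1 hpos[OF i1(1)] M hq[of i1] by (auto simp: zero_less_mult_iff)
      hence "\<not> is_unit (q i1)" by auto
      then obtain p where p: "prime p" "p dvd q i1" using \<open>q i1 > 0\<close>
        by (metis prime_divisor_exists less_irrefl)
      \<comment> \<open>Split the class of \<open>x\<close> into \<open>p\<close> classes modulo \<open>p * M\<close>. Each contains a tile of its own, so
        handling them one after another saves a factor 2 each time, and \<open>p \<le> 2 ^ (p - 1)\<close>.\<close>
      have p1: "p \<ge> 2" using p(1) by (simp add: prime_ge_2_int)
      define T where "T = {i\<in>I. \<not> p dvd q i}"
      define K where "K j = {i\<in>I. p dvd q i \<and> p * M dvd s i - (x + int j * M)}" for j
      define Q where "Q = (\<Prod>i\<in>T. q i)"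
      have finT: "finite T" "finite (K j)" for j using fin by (auto simp: T_def K_def)
      have pQ: "\<not> p dvd Q" unfolding Q_def using p(1) finT(1)
        by (auto simp: prime_dvd_prod_iff T_def)
      hence cop: "coprime p Q" using p(1) by (simp add: prime_imp_coprime)
      have hQ: "h i dvd Q * M" if "i \<in> T" for i
        unfolding hq Q_def using that finT(1) by (intro mult_dvd_mono dvd_prodI) auto
      have pM: "p * M dvd h i" if "p dvd q i" for i using that by (simp add: hq mult_dvd_mono)
      \<comment> \<open>Adding multiples of \<open>Q * M\<close> does not affect membership in the
        tiles of \<open>T\<close>. As \<open>p\<close> is coprime to \<open>Q\<close>, such
        additions reach every class modulo \<open>p * M\<close> inside the class of
        \<open>x\<close>.\<close>
      have adjust: "\<exists>a. p * M dvd (n + a * (Q * M)) - (x + int j * M)" if "M dvd n - x" for n j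
      proof -
        obtain k where k: "n - x = k * M" using \<open>M dvd n - x\<close> by (metis dvdE mult.commute)
        obtain u v where "u * p + v * Q = 1" using cop by (metis bezout_int coprime_imp_gcd_eq_1)
        hence "k + (int j - k) * v * Q - int j = p * (u * (k - int j))" by algebra
        hence "(n + ((int j - k) * v) * (Q * M)) - (x + int j * M) = p * M * (u * (k - int j))"
          using k by algebra
        thus ?thesis by (metis dvd_triv_left)
      qed
      \<comment> \<open>The point \<open>s i1\<close> is moved into subclass \<open>j\<close> by a
        multiple of \<open>Q * M\<close>. No tile of \<open>T\<close> contains \<open>s i1\<close>,
        hence none contains the new point, and the tile covering it belongs to
        \<open>K j\<close>.\<close>
      have Kne: "K j \<noteq> {}" for j
      proof -
        obtain a where a: "p * M dvd (s i1 + a * (Q * M)) - (x + int j * M)"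
          using adjust[OF Ms[OF i1(1)]] by blast
        let ?n = "s i1 + a * (Q * M)"
        have "M dvd (?n - (x + int j * M)) + int j * M"
          using a dvd_mult_right by (intro dvd_add) auto
        hence "M dvd ?n - x" by (simp add: algebra_simps)
        then obtain i where i: "i \<in> I" "h i dvd ?n - s i" using cov by blast
        have "p dvd q i"
        proof (rule ccontr)
          assume "\<not> p dvd q i"
          hence "h i dvd Q * M" using hQ i(1) by (auto simp: T_def)
          hence "h i dvd s i1 - s i" 
            using dvd_shift[of "h i" "Q * M" ?n "s i1" "s i"] i(2) by simp
          hence "i = i1" using disj[of i i1 "s i1"] i i1 by simp
          thus False using p \<open>\<not> p dvd q i\<close> by simp
        qed
        moreover have "p * M dvd s i - (x + int j * M)"
        proof -
          have "p * M dvd ?n - s i" using pM[OF \<open>p dvd q i\<close>] i(2) by (rule dvd_trans)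
          hence "p * M dvd (?n - (x + int j * M)) - (?n - s i)" using a by (rule dvd_diff[rotated])
          thus ?thesis by (simp add: algebra_simps)
        qed
        ultimately show ?thesis using i(1) by (auto simp: K_def)
      qed
      have Kdisj: "K j \<inter> K l = {}" if "j \<noteq> l" "j < nat p" "l < nat p" for j l
      proof (rule ccontr)
        assume "K j \<inter> K l \<noteq> {}"
        then obtain i where "p * M dvd s i - (x + int j * M)" "p * M dvd s i - (x + int l * M)"
          by (auto simp: K_def)
        hence "p * M dvd (s i - (x + int j * M)) - (s i - (x + int l * M))" by (rule dvd_diff)
        hence "p * M dvd (int l - int j) * M" by (simp add: algebra_simps)
        hence "p dvd int l - int j" using M by simp
        thus False using that zdvd_not_zless[of "int l - int j" p] zdvd_not_zless[of "int j - int l" p]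
            dvd_diff_commute[of p "int l" "int j"] by linarith
      qed
      have KT: "K j \<inter> T = {}" for j by (auto simp: K_def T_def)
      have un: "I = T \<union> (\<Union>j<nat p. K j)"
      proof (intro equalityI subsetI)
        fix i assume i: "i \<in> I"
        show "i \<in> T \<union> (\<Union>j<nat p. K j)"
        proof (cases "p dvd q i")
          case True
          obtain k where k: "s i - x = k * M" using Ms[OF i] by (metis dvdE mult.commute)
          have "p * M dvd s i - (x + int (nat (k mod p)) * M)"
          proof -
            have "s i - (x + (k mod p) * M) = (k - k mod p) * M" using k by (simp add: algebra_simps)
            also have "k - k mod p = p * (k div p)" by (simp add: minus_mod_eq_mult_div)
            finally show ?thesis using p1 by simp
          qed
          hence "i \<in> K (nat (k mod p))" using i True by (simp add: K_def)
          moreover have "nat (k mod p) < nat p" using p1 by simp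
          ultimately show ?thesis by blast
        qed (use i in \<open>auto simp: T_def\<close>)
      qed (auto simp: T_def K_def)
      have cardI: "card I = card T + (\<Sum>j<nat p. card (K j))"
      proof -
        have "card I = card T + card (\<Union>j<nat p. K j)"
          unfolding un by (rule card_Un_disjoint) (use finT KT in auto)
        also have "card (\<Union>j<nat p. K j) = (\<Sum>j<nat p. card (K j))"
          by (rule card_UN_disjoint) (use finT Kdisj in auto)
        finally show ?thesis .
      qed
      have Kpos: "card (K j) > 0" for j using Kne finT by (simp add: card_gt_0_iff)
      have two: "nat p \<ge> 2" using p1 by linarith
      have sum2: "card (K j) + card (K l) \<le> (\<Sum>j<nat p. card (K j))" if "j \<noteq> l" "j < nat p" "l < nat p" for j l
        using sum_mono2[of "{..<nat p}" "{j, l}" "\<lambda>j. card (K j)"] that by simp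
      have step: "\<exists>L>0. L \<le> 2 ^ (card T + (\<Sum>l<Suc j. card (K l) - 1)) * (p * M) \<and> p * M dvd L \<and>
           (\<forall>i\<in>T \<union> (\<Union>l<Suc j. K l). h i dvd L)" if "Suc j \<le> nat p" for j
        using that
      proof (induction j)
        case 0
        \<comment> \<open>Every tile of \<open>T\<close> meets subclass 0, so \<open>T\<close> is
          handled together with \<open>K 0\<close>.\<close>
        define Y where "Y = {i\<in>I. \<exists>n. h i dvd n - s i \<and> p * M dvd n - x}"
        have Y: "Y = T \<union> K 0"
        proof (intro equalityI subsetI)
          fix i assume "i \<in> Y"
          then obtain n where n: "i \<in> I" "h i dvd n - s i" "p * M dvd n - x" by (auto simp: Y_def)
          show "i \<in> T \<union> K 0"
          proof (cases "p dvd q i")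
            case True
            have "p * M dvd (n - x) - (n - s i)"
              using n(3) dvd_trans[OF pM[OF True] n(2)] by (rule dvd_diff)
            thus ?thesis using n True by (auto simp: K_def)
          qed (use n in \<open>auto simp: T_def\<close>)
        next
          fix i assume i: "i \<in> T \<union> K 0"
          hence "i \<in> I" by (auto simp: T_def K_def)
          show "i \<in> Y"
          proof (cases "i \<in> T")
            case True
            obtain a where "p * M dvd (s i + a * (Q * M)) - (x + int 0 * M)"
              using adjust[OF Ms[OF \<open>i \<in> I\<close>]] by blast
            moreover have "h i dvd (s i + a * (Q * M)) - s i" using hQ[OF True] by simp
            ultimately show ?thesis using \<open>i \<in> I\<close>
              unfolding Y_def by (auto intro!: exI[of _ "s i + a * (Q * M)"])
          next
            case False
            hence "p * M dvd s i - x" using i by (auto simp: K_def)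
            thus ?thesis using \<open>i \<in> I\<close> unfolding Y_def by (auto intro!: exI[of _ "s i"])
          qed
        qed
        have pMpos: "p * M > 0" using M p1 by simp
        have per': "periodic_set (p * M) {n. M dvd n - x}"
          unfolding periodic_set_def
        proof (intro conjI allI impI)
          fix n n' assume "p * M dvd n - n'" "n \<in> {n. M dvd n - x}"
          thus "n' \<in> {n. M dvd n - x}" using dvd_shift[of M "p * M" n n' x] by simp
        qed (use M p1 in simp)
        obtain s' where t': "tiles {n. p * M dvd n - x} Y s' (\<lambda>i. lcm (h i) (p * M))"
          using tiles_residue_class[OF th per', of x] unfolding Y_def by auto
        have "card Y = card T + card (K 0)" unfolding Y using finT KT[of 0] by (subst card_Un_disjoint) auto
        moreover have "card (K 0) + card (K 1) \<le> (\<Sum>j<nat p. card (K j))" using two by (intro sum2) auto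
        ultimately have "card Y < card I" using cardI Kpos[of 1] by linarith
        from IH[OF this t' periodic_set_residue_class[OF pMpos] residue_class_nonempty] obtain L where
          "L > 0" "L \<le> 2 ^ (card Y - 1) * (p * M)" "p * M dvd L" "\<forall>i\<in>Y. lcm (h i) (p * M) dvd L"
          by blast
        moreover have "card Y - 1 = card T + (card (K 0) - 1)"
          using \<open>card Y = _\<close> Kpos[of 0] by linarith
        ultimately show ?case using Y by auto
      next
        case (Suc j)
        then obtain L0 where L0: "L0 > 0" "L0 \<le> 2 ^ (card T + (\<Sum>l<Suc j. card (K l) - 1)) * (p * M)" 
          "p * M dvd L0" "\<forall>i\<in>T \<union> (\<Union>l<Suc j. K l). h i dvd L0" by auto
        define Y where "Y = {n. \<exists>i\<in>K (Suc j). h i dvd n - s i}"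
        have tY: "tiles Y (K (Suc j)) s h" unfolding Y_def by (rule tiles_subset[OF th]) (auto simp: K_def)
        \<comment> \<open>Subclass \<open>Suc j\<close> without the tiles of \<open>T\<close> is
          covered by \<open>K (Suc j)\<close> alone, and \<open>L0\<close> is already a period of
          both the subclass and those tiles.\<close>
        have Y: "n \<in> Y \<longleftrightarrow> p * M dvd n - (x + int (Suc j) * M) \<and> \<not> (\<exists>i\<in>T. h i dvd n - s i)" for n
        proof
          assume "n \<in> Y"
          then obtain i where i: "i \<in> K (Suc j)" "h i dvd n - s i" by (auto simp: Y_def)
          hence ps: "p dvd q i" "p * M dvd s i - (x + int (Suc j) * M)" by (auto simp: K_def)
          have "p * M dvd (n - s i) + (s i - (x + int (Suc j) * M))"
            using dvd_trans[OF pM[OF ps(1)] i(2)] ps(2) by (rule dvd_add)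
          hence "p * M dvd n - (x + int (Suc j) * M)" by (simp add: algebra_simps)
          moreover have "\<not> h i' dvd n - s i'" if "i' \<in> T" for i'
            using disj[of i i' n] that i KT[of "Suc j"] by (auto simp: T_def K_def)
          ultimately show "p * M dvd n - (x + int (Suc j) * M) \<and> \<not> (\<exists>i\<in>T. h i dvd n - s i)" by blast
        next
          assume n: "p * M dvd n - (x + int (Suc j) * M) \<and> \<not> (\<exists>i\<in>T. h i dvd n - s i)"
          have "M dvd (n - (x + int (Suc j) * M)) + int (Suc j) * M"
            using n dvd_mult_right by (intro dvd_add) auto
          hence "M dvd n - x" by (simp add: algebra_simps)
          then obtain i where i: "i \<in> I" "h i dvd n - s i" using cov by blast
          hence pq: "p dvd q i" using n by (auto simp: T_def)
          have "p * M dvd (n - (x + int (Suc j) * M)) - (n - s i)"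
            using conjunct1[OF n] dvd_trans[OF pM[OF pq] i(2)] by (rule dvd_diff)
          hence "p * M dvd s i - (x + int (Suc j) * M)" by (simp add: algebra_simps)
          thus "n \<in> Y" using i pq by (auto simp: Y_def K_def)
        qed
        have "periodic_set L0 Y" unfolding periodic_set_def
        proof (intro conjI allI impI)
          fix n n' assume n: "L0 dvd n - n'" "n \<in> Y"
          have "p * M dvd n - (x + int (Suc j) * M) \<longleftrightarrow> p * M dvd n' - (x + int (Suc j) * M)"
            by (rule dvd_shift[OF L0(3) n(1)])
          moreover have "h i dvd n - s i \<longleftrightarrow> h i dvd n' - s i" if "i \<in> T" for i
            by (rule dvd_shift[OF _ n(1)]) (use L0(4) that in auto)
          ultimately show "n' \<in> Y" using Y n(2) by blast
        qed (rule L0)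
        moreover have "Y \<noteq> {}"
        proof -
          obtain i where "i \<in> K (Suc j)" using Kne by auto
          hence "s i \<in> Y" by (auto simp: Y_def intro!: bexI[of _ i])
          thus ?thesis by auto
        qed
        moreover have "card (K (Suc j)) < card I"
        proof -
          have "card (K 0) + card (K (Suc j)) \<le> (\<Sum>j<nat p. card (K j))" using Suc.prems by (intro sum2) auto
          thus ?thesis using cardI Kpos[of 0] by linarith
        qed
        ultimately obtain L where L: "L > 0" "L \<le> 2 ^ (card (K (Suc j)) - 1) * L0" "L0 dvd L" 
           "\<forall>i\<in>K (Suc j). h i dvd L" using IH[OF _ tY] by blast
        have "L \<le> 2 ^ (card (K (Suc j)) - 1) * (2 ^ (card T + (\<Sum>l<Suc j. card (K l) - 1)) * (p * M))"
          by (rule order_trans[OF L(2)], rule mult_left_mono[OF L0(2)]) simp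
        also have "\<dots> = 2 ^ (card T + (\<Sum>l<Suc (Suc j). card (K l) - 1)) * (p * M)"
          by (simp add: power_add)
        finally have "L \<le> 2 ^ (card T + (\<Sum>l<Suc (Suc j). card (K l) - 1)) * (p * M)" .
        moreover have "p * M dvd L" using L0(3) L(3) by (rule dvd_trans)
        moreover have "\<forall>i\<in>T \<union> (\<Union>l<Suc (Suc j). K l). h i dvd L"
        proof
          fix i assume "i \<in> T \<union> (\<Union>l<Suc (Suc j). K l)"
          hence "i \<in> K (Suc j) \<or> i \<in> T \<union> (\<Union>l<Suc j. K l)" by (auto simp: lessThan_Suc)
          thus "h i dvd L" using L0(4) L(4) dvd_trans[OF _ L(3)] by blast
        qed
        ultimately show ?case using L(1) by blast
      qed
      have "Suc (nat p - 1) = nat p" using two by simp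
      with step[of "nat p - 1"] obtain L where L: "L > 0" 
        "L \<le> 2 ^ (card T + (\<Sum>l<nat p. card (K l) - 1)) * (p * M)" "p * M dvd L" "\<forall>i\<in>I. h i dvd L"
        unfolding un by auto
      \<comment> \<open>The \<open>p\<close> reduced exponents save \<open>p\<close> factors of 2:
        one accounts for the exponent \<open>card I - 1\<close>, the other \<open>p - 1\<close> pay
        for the factor \<open>p\<close>.\<close>
      have "(\<Sum>l<nat p. card (K l) - 1) + nat p = (\<Sum>l<nat p. (card (K l) - 1) + 1)"
        by (subst sum.distrib) simp
      also have "\<dots> = (\<Sum>l<nat p. card (K l))" using Kpos by (intro sum.cong) auto
      finally have e: "card T + (\<Sum>l<nat p. card (K l) - 1) + (nat p - 1) = card I - 1"
        using cardI two by linarith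
      have pp: "p \<le> 2 ^ (nat p - 1)"
      proof -
        have "nat p \<le> 2 ^ (nat p - 1)" 
          using self_le_ge2_pow[of 2 "nat p"] less_exp[of "nat p - 1"] two by linarith
        hence "int (nat p) \<le> int (2 ^ (nat p - 1))" by (simp only: of_nat_le_iff)
        thus ?thesis using p1 by simp
      qed
      have "L \<le> 2 ^ (card T + (\<Sum>l<nat p. card (K l) - 1)) * (2 ^ (nat p - 1) * M)"
        by (rule order_trans[OF L(2)], rule mult_left_mono, rule mult_right_mono[OF pp]) (use M in auto)
      also have "\<dots> = 2 ^ (card I - 1) * M" unfolding e[symmetric] by (simp only: power_add mult.assoc)
      finally have "L \<le> 2 ^ (card I - 1) * M" .
      moreover have "M dvd L" using L(3) by (rule dvd_mult_right)
      moreover have "\<forall>i\<in>I. g i dvd L" using L(4) dvd_trans[OF gh] by blast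
      ultimately show ?thesis using L(1) by blast
    qed
  qed
qed

section \<open>From constant gaps to short periods\<close>

lemma constant_gap_class:
  assumes P: "P > 0" "\<And>n. y (n + P) = y n" and a: "a \<in> range y" and f: "f > 0"
    and gap: "\<And>n n'. y n = a \<Longrightarrow> y n' = a \<Longrightarrow> real (cnt {a} y n) - real (cnt {a} y n') = f * (real n - real n')"
  shows "\<exists>g r :: int. g > 0 \<and> g dvd int P \<and> (\<forall>n. y n = a \<longleftrightarrow> g dvd int n - r)"
proof -
  have "\<exists>j. y j = a \<and> cnt {a} y j = Suc (cnt {a} y n)" if n: "y n = a" for n
  proof -
    have "y (n + 1 * P) = a" unfolding periodic_add_mult[of y, OF P(2)] by (rule n)
    moreover have "cnt {a} y (Suc n) \<le> cnt {a} y (n + P)" using P(1) by (intro cnt_mono) auto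
    ultimately have "cnt {a} y (Suc (n + P)) > Suc (cnt {a} y n)" using n by (simp add: cnt_Suc)
    thus ?thesis using cnt_crossing by blast
  qed
  \<comment> \<open>The next occurrence raises the count by 1, so \<open>gap\<close> places it
    exactly \<open>1 / f\<close> further on.\<close>
  hence nxt: "\<exists>j. y j = a \<and> real j - real n = 1 / f" if "y n = a" for n
    using gap[OF _ that] that f by (fastforce simp: field_simps)
  obtain r where r: "y r = a" using a by auto
  obtain j where j: "real j - real r = 1 / f" using nxt[OF r] by blast
  define g where "g = j - r"
  have "j > r" using j f by (metis diff_gt_0_iff_gt of_nat_less_iff zero_less_divide_1_iff)
  hence g: "g > 0" "real g = 1 / f" using j by (auto simp: g_def of_nat_diff)
  have step: "y (n + g) = a" if n: "y n = a" for n
  proof -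
    obtain j where j: "y j = a" "real j - real n = real g" using nxt[OF n] g(2) by auto
    hence "real j = real (n + g)" by simp
    thus ?thesis using j(1) by (simp only: of_nat_eq_iff)
  qed
  have steps: "y (n + k * g) = a" if n: "y n = a" for n k
  proof (induction k)
    case (Suc k)
    show ?case using step[OF Suc] by (simp add: ac_simps)
  qed (use n in simp)
  have dvd: "int g dvd int n - int n'" if "y n = a" "y n' = a" for n n'
  proof -
    have "real n - real n' = real g * (real (cnt {a} y n) - real (cnt {a} y n'))"
      using gap[OF that] f g(2) by simp
    hence "real_of_int (int n - int n') = real_of_int (int g * (int (cnt {a} y n) - int (cnt {a} y n')))"
      by simp
    hence "int n - int n' = int g * (int (cnt {a} y n) - int (cnt {a} y n'))" by (simp only: of_int_eq_iff)
    thus ?thesis by simp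
  qed
  have gP: "int g dvd int P"
    using dvd[of "r + P" r] r P(2) by simp
  have "y n = a \<longleftrightarrow> int g dvd int n - int r" for n
  proof
    assume d: "int g dvd int n - int r"
    \<comment> \<open>\<open>steps\<close> only moves forward from \<open>r\<close>, so a position
      before \<open>r\<close> is first carried past it by \<open>r\<close> periods.\<close>
    have "r \<le> r * P" using P(1) by simp
    have "int g dvd (int n - int r) + int r * int P" using d gP by simp
    also have "(int n - int r) + int r * int P = int (n + r * P - r)"
      using trans_le_add2[OF \<open>r \<le> r * P\<close>, of n] by (simp only: of_nat_diff) simp
    finally have "g dvd n + r * P - r" by (simp only: int_dvd_int_iff)
    then obtain k where "n + r * P - r = k * g" by (metis dvdE mult.commute)
    hence "n + r * P = r + k * g" using \<open>r \<le> r * P\<close> by linarith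
    hence "y (n + r * P) = a" using steps[OF r] by simp
    thus "y n = a" using periodic_add_mult[of y, OF P(2)] by simp
  qed (use dvd r in blast)
  hence "\<forall>n. y n = a \<longleftrightarrow> int g dvd int n - int r" by blast
  moreover have "int g > 0" using g(1) by simp
  ultimately show ?thesis using gP by blast
qed

text \<open>Each letter occupies one residue class. Reading \<open>y\<close> at
  \<open>z mod int P\<close> extends these classes to an exact cover of the integers, whose common
  period is bounded by the case \<open>M = 1\<close>.\<close>

lemma constant_gaps_short_period:
  assumes P: "P > 0" "\<And>n. y (n + P) = y n" and fin: "finite (range y)"
    and gap: "\<And>a. a \<in> range y \<Longrightarrow> \<exists>f>0. \<forall>n n'. y n = a \<longrightarrow> y n' = a \<longrightarrow>
         real (cnt {a} y n) - real (cnt {a} y n') = f * (real n - real n')"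
  shows "\<exists>L>0. L \<le> 2 ^ (card (range y) - 1) \<and> (\<forall>n. y (n + L) = y n)"
proof -
  have "\<exists>g r :: int. g > 0 \<and> g dvd int P \<and> (\<forall>n. y n = a \<longleftrightarrow> g dvd int n - r)" if a: "a \<in> range y" for a
  proof -
    obtain f where "f > 0" "\<And>n n'. y n = a \<Longrightarrow> y n' = a \<Longrightarrow>
         real (cnt {a} y n) - real (cnt {a} y n') = f * (real n - real n')" using gap[OF a] by blast
    thus ?thesis using constant_gap_class[of P y, OF P a] by blast
  qed
  then obtain g r where gr: "\<And>a. a \<in> range y \<Longrightarrow> g a > (0::int) \<and> g a dvd int P \<and> (\<forall>n. y n = a \<longleftrightarrow> g a dvd int n - r a)"
    by metis
  have ext: "g a dvd z - r a \<longleftrightarrow> y (nat (z mod int P)) = a" if a: "a \<in> range y" for a z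
  proof -
    have "z mod int P \<ge> 0" using P(1) by simp
    moreover have "g a dvd z - r a \<longleftrightarrow> g a dvd z mod int P - r a"
    proof (rule dvd_shift[of _ "int P"])
      show "int P dvd z - z mod int P" by (rule dvd_minus_mod)
    qed (use gr[OF a] in blast)
    ultimately show ?thesis using gr[OF a] by simp
  qed
  have "tiles UNIV (range y) r g"
    unfolding tiles_def
  proof (intro conjI allI ballI impI)
    show "g a > 0" if "a \<in> range y" for a using gr[OF that] by blast
    show "z \<in> UNIV \<longleftrightarrow> (\<exists>a\<in>range y. g a dvd z - r a)" for z
    proof -
      have "g (y (nat (z mod int P))) dvd z - r (y (nat (z mod int P)))"
        unfolding ext[OF rangeI] by (rule refl)
      thus ?thesis by blast
    qed
    show "a = b" if "a \<in> range y" "b \<in> range y" "g a dvd z - r a" "g b dvd z - r b" for a b z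
      using that(3,4) unfolding ext[OF that(1)] ext[OF that(2)] by simp
  qed (rule fin)
  moreover have "periodic_set 1 UNIV" by (simp add: periodic_set_def)
  ultimately obtain L where L: "L > 0" "L \<le> 2 ^ (card (range y) - 1) * 1" "\<forall>a\<in>range y. g a dvd L"
    using tiles_common_period by blast
  have "y (n + nat L) = y n" for n
  proof -
    have "y n \<in> range y" by simp
    note G = gr[OF this]
    have "g (y n) dvd int n - r (y n)" using G by blast
    hence "g (y n) dvd (int n - r (y n)) + L" using L(3) by simp
    also have "(int n - r (y n)) + L = int (n + nat L) - r (y n)" using L(1) by simp
    finally show ?thesis using G by blast
  qed
  moreover have "nat L \<le> 2 ^ (card (range y) - 1)" using L(2) by (simp add: nat_le_iff)
  ultimately show ?thesis using L(1) by (intro exI[of _ "nat L"]) auto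
qed

section \<open>Long repetitions\<close>

text \<open>Otherwise \<open>k\<close> consecutive blocks of length \<open>G\<close> contain at
  least \<open>k\<close> bad positions, against at most \<open>k * G * e + C\<close>, which is
  impossible for large \<open>k\<close>.\<close>

lemma sparse_imp_gap:
  fixes e C :: real and bad :: "nat \<Rightarrow> bool"
  assumes sparse: "\<And>i. real (cnt {True} bad i) \<le> real i * e + C" and G: "real G * e < 1"
  shows "\<exists>i. \<forall>j<G. \<not> bad (i + j)"
proof (rule ccontr)
  assume *: "\<not> ?thesis"
  have step: "cnt {True} bad i < cnt {True} bad (i + G)" for i
  proof -
    obtain j where j: "j < G" "bad (i + j)" using * by blast
    have "cnt {True} bad i \<le> cnt {True} bad (i + j)" by (rule cnt_mono) simp
    also have "\<dots> < cnt {True} bad (Suc (i + j))" using j by (simp add: cnt_Suc)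
    also have "\<dots> \<le> cnt {True} bad (i + G)" using j by (intro cnt_mono) simp
    finally show ?thesis .
  qed
  have "k \<le> cnt {True} bad (k * G)" for k
  proof (induction k)
    case (Suc k)
    show ?case using Suc step[of "k * G"] by (simp add: add.commute)
  qed simp
  hence b: "real k * (1 - real G * e) \<le> C" for k
  proof -
    have "real k \<le> real (k * G) * e + C" using \<open>k \<le> _\<close> sparse[of "k * G"] by (meson of_nat_le_iff order_trans)
    thus ?thesis by (simp add: algebra_simps)
  qed
  obtain k :: nat where "real k * (1 - real G * e) > C" using reals_Archimedean3[of "1 - real G * e"] G by auto
  thus False using b[of k] by simp
qed

text \<open>Trades \<open>k\<close> terms for \<open>t\<close> terms, so that bounded differences
  give an estimate independent of \<open>k\<close>.\<close>

lemma sum_shift_difference: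
  fixes \<theta> :: "nat \<Rightarrow> real"
  shows "(\<Sum>i<k. \<theta> (i + t) - \<theta> i) = (\<Sum>i<t. \<theta> (i + k) - \<theta> i)"
proof (induction k)
  case (Suc k)
  have "(\<Sum>i<t. \<theta> (i + Suc k) - \<theta> i) - (\<Sum>i<t. \<theta> (i + k) - \<theta> i) = (\<Sum>i<t. \<theta> (Suc i + k) - \<theta> (i + k))"
    by (simp add: sum_subtractf)
  also have "\<dots> = \<theta> (k + t) - \<theta> k"
    using sum_lessThan_telescope[of "\<lambda>i. \<theta> (i + k)" t] by (simp add: add.commute)
  finally show ?case using Suc by simp
qed simp

text \<open>The surplus \<open>k i\<close> of letters of \<open>A\<close> in a window of length
  \<open>t\<close> is an integer within 1 of \<open>e\<close>, hence 0 or the sign of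
  \<open>e\<close>, and its mean is \<open>e\<close>. Nonzero surpluses thus have density
  \<open>\<bar>e\<bar>\<close>, and some stretch of nearly \<open>1 / \<bar>e\<bar>\<close>
  positions avoids them. Where two consecutive surpluses vanish, both counts advance by multiples of
  the periods and the letters agree.\<close>

lemma interleaved_run:
  fixes \<alpha> :: real
  assumes il: "interleaves w A y z" and y: "\<And>n. y (n + P) = y n" and z: "\<And>n. z (n + Q) = z n"
    and bal: "\<And>i j. \<bar>(real (cnt A w i) - real i * \<alpha>) - (real (cnt A w j) - real j * \<alpha>)\<bar> \<le> 1"
    and t: "t = m * P + n * Q" and e: "e = real t * \<alpha> - real (m * P)" "e \<noteq> 0" "\<bar>e\<bar> < 1"
  shows "\<exists>i L. real L \<ge> 1 / \<bar>e\<bar> - 2 \<and> (\<forall>j<L. w (i + j) = w (i + t + j))"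
proof -
  define \<theta> where "\<theta> i = real (cnt A w i) - real i * \<alpha>" for i
  define k where "k i = int (cnt A w (i + t)) - int (cnt A w i) - int (m * P)" for i
  have k\<theta>: "real_of_int (k i) = \<theta> (i + t) - \<theta> i + e" for i
    by (simp add: k_def \<theta>_def e algebra_simps)
  have k\<theta>1: "\<bar>real_of_int (k i) - e\<bar> \<le> 1" for i using bal[of "i + t" i] unfolding k\<theta> \<theta>_def by (simp only: add_diff_cancel_right')
  define s :: real where "s = sgn e"
  have s: "s * e = \<bar>e\<bar>" "\<bar>s\<bar> = 1" using e(2) by (auto simp: s_def sgn_if)
  have ks: "(if k i \<noteq> 0 then 1 else 0) = s * real_of_int (k i)" for i
  proof (cases "e > 0")
    case True
    hence "real_of_int (k i) > -1" "real_of_int (k i) < 2" using k\<theta>1[of i] e(3) by linarith+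
    hence "k i = 0 \<or> k i = 1" by linarith
    thus ?thesis using True by (auto simp: s_def)
  next
    case False
    hence "e < 0" using e(2) by simp
    hence "real_of_int (k i) > -2" "real_of_int (k i) < 1" using k\<theta>1[of i] e(3) by linarith+
    hence "k i = 0 \<or> k i = -1" by linarith
    thus ?thesis using \<open>e < 0\<close> by (auto simp: s_def)
  qed
  define bad where "bad i \<longleftrightarrow> k i \<noteq> 0" for i
  have "real (cnt {True} bad l) \<le> real l * \<bar>e\<bar> + real t" for l
  proof -
    have "real (cnt {True} bad l) = (\<Sum>i<l. s * real_of_int (k i))"
      by (induction l) (auto simp: cnt_Suc bad_def ks[symmetric])
    also have "\<dots> = s * (\<Sum>i<l. \<theta> (i + t) - \<theta> i) + real l * \<bar>e\<bar>"
      unfolding k\<theta> s(1)[symmetric] by (simp add: sum_distrib_left sum.distrib sum_subtractf algebra_simps)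
    also have "s * (\<Sum>i<l. \<theta> (i + t) - \<theta> i) \<le> \<bar>\<Sum>i<t. \<theta> (i + l) - \<theta> i\<bar>"
      unfolding sum_shift_difference using s(2) abs_ge_self[of "s * (\<Sum>i<t. \<theta> (i + l) - \<theta> i)"] by (simp add: abs_mult)
    also have "\<dots> \<le> (\<Sum>i<t. 1)"
      by (rule order_trans[OF sum_abs], rule sum_mono) (simp only: \<theta>_def bal)
    finally show ?thesis by simp
  qed
  \<comment> \<open>The largest integer strictly below \<open>1 / \<bar>e\<bar>\<close>.\<close>
  moreover define G where "G = nat (\<lceil>1 / \<bar>e\<bar>\<rceil> - 1)"
  have "1 / \<bar>e\<bar> > 0" using e(2) by simp
  hence G: "real G < 1 / \<bar>e\<bar>" "real G \<ge> 1 / \<bar>e\<bar> - 1" unfolding G_def by linarith+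
  moreover have "real G * \<bar>e\<bar> < 1" using G(1) e(2) by (simp add: field_simps)
  ultimately obtain i where i: "\<And>j. j < G \<Longrightarrow> \<not> bad (i + j)" using sparse_imp_gap by blast
  have same: "w i = w (i + t)" if k0: "k i = 0" "k (Suc i) = 0" for i
  proof -
    have iff: "w (i + t) \<in> A \<longleftrightarrow> w i \<in> A" using k0 by (auto simp: k_def cnt_Suc split: if_splits)
    have c: "cnt A w (i + t) = cnt A w i + m * P" using k0(1) unfolding k_def by linarith
    have c': "cnt (- A) w (i + t) = cnt (- A) w i + n * Q"
      using c cnt_compl[of A w i] cnt_compl[of A w "i + t"] t by linarith
    have W: "w i = (if w i \<in> A then y (cnt A w i) else z (cnt (- A) w i))" for i
      using il unfolding interleaves_def by blast
    have "y (cnt A w (i + t)) = y (cnt A w i)" "z (cnt (- A) w (i + t)) = z (cnt (- A) w i)"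
      unfolding c c' by (rule periodic_add_mult[of y, OF y], rule periodic_add_mult[of z, OF z])
    thus ?thesis using W[of i] W[of "i + t"] iff by metis
  qed
  \<comment> \<open>One position is lost, since agreement needs surplus 0 before and after the
    letter.\<close>
  have "w (i + j) = w (i + t + j)" if "j < G - 1" for j
  proof -
    have "\<not> bad (i + j)" "\<not> bad (i + Suc j)" using i[of j] i[of "Suc j"] that by auto
    thus ?thesis using same[of "i + j"] by (simp add: bad_def ac_simps)
  qed
  moreover have "real (G - 1) \<ge> 1 / \<bar>e\<bar> - 2" using G(2) by linarith
  ultimately show ?thesis by blast
qed

text \<open>The error \<open>t * \<alpha> - m * P\<close> equals
  \<open>P * (1 - \<alpha>) * (n * \<gamma> - m)\<close>, so good fractions \<open>m / n\<close> for
  \<open>\<gamma>\<close> make it at most \<open>P * (1 - \<alpha>) / n\<close>. Since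
  \<open>t\<close> is about \<open>n * Q / (1 - \<alpha>)\<close>, the product of \<open>t\<close>
  and the error is at most about \<open>P * Q\<close>.\<close>

lemma interleaved_long_runs:
  fixes \<alpha> \<eta> :: real
  assumes il: "interleaves w A y z" and y: "\<And>n. y (n + P) = y n" and z: "\<And>n. z (n + Q) = z n"
    and bal: "\<And>i j. \<bar>(real (cnt A w i) - real i * \<alpha>) - (real (cnt A w j) - real j * \<alpha>)\<bar> \<le> 1"
    and \<alpha>: "0 < \<alpha>" "\<alpha> < 1" "\<alpha> \<notin> \<rat>" and PQ: "P > 0" "Q > 0" and \<eta>: "\<eta> > 0"
  shows "\<exists>t>T. \<exists>i L. real L \<ge> real t * (1 / real (P * Q) - \<eta>) \<and> (\<forall>j<L. w (i + j) = w (i + t + j))"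
proof -
  define \<gamma> where "\<gamma> = (real Q * \<alpha>) / (real P * (1 - \<alpha>))"
  have \<gamma>: "\<gamma> > 0" using \<alpha> PQ by (simp add: \<gamma>_def)
  have "\<gamma> \<notin> \<rat>"
  proof
    assume "\<gamma> \<in> \<rat>"
    from Rats_mult[OF this, of "real P / real Q"] have "\<gamma> * (real P / real Q) \<in> \<rat>" by simp
    moreover have "\<gamma> * (real P / real Q) = \<alpha> / (1 - \<alpha>)" using PQ \<alpha> by (simp add: \<gamma>_def)
    ultimately have "\<alpha> / (1 - \<alpha>) \<in> \<rat>" by simp
    from Rats_divide[OF this Rats_add[OF this Rats_1]] have "\<alpha> / (1 - \<alpha>) / (\<alpha> / (1 - \<alpha>) + 1) \<in> \<rat>" .
    moreover have "\<alpha> / (1 - \<alpha>) / (\<alpha> / (1 - \<alpha>) + 1) = \<alpha>" using \<alpha> by (simp add: field_simps)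
    ultimately show False using \<alpha>(3) by simp
  qed
  hence inf: "infinite (approx_set \<gamma>)" using rational_iff_finite_approx_set by blast
  \<comment> \<open>The entries ensure, in order: \<open>t > T\<close>; absorption of the lost 2 in
    the run length; \<open>\<delta> \<le> \<eta> / 2\<close>; an error below 1; a positive
    denominator.\<close>
  define N where "N = Max {int T, \<lceil>6 / \<eta>\<rceil>, \<lceil>2 * (real P)\<^sup>2 / \<eta>\<rceil>, int P, 1}"
  have N: "int T \<le> N" "\<lceil>6 / \<eta>\<rceil> \<le> N" "\<lceil>2 * (real P)\<^sup>2 / \<eta>\<rceil> \<le> N" "int P \<le> N" "1 \<le> N"
    unfolding N_def by (auto intro!: Max_ge)
  obtain h k where hk: "(h, k) \<in> approx_set \<gamma>" "k > N" using infinite_approx_set[OF inf] by blast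
  define n where "n = nat k"
  have n: "real n = of_int k" "n > 0" using hk(2) N(5) by (auto simp: n_def)
  have "\<bar>\<gamma> - of_int h / of_int k\<bar> < 1 / (of_int k)\<^sup>2" using hk(1) by (simp add: approx_set_def)
  hence "\<bar>\<gamma> - of_int h / real n\<bar> * real n < 1 / (real n)\<^sup>2 * real n"
    unfolding n(1)[symmetric] using n(2) by (intro mult_strict_right_mono) auto
  hence "\<bar>(\<gamma> - of_int h / real n) * real n\<bar> < 1 / real n" using n by (simp add: abs_mult power2_eq_square)
  moreover have "(\<gamma> - of_int h / real n) * real n = real n * \<gamma> - of_int h" using n(2) by (simp add: field_simps)
  ultimately have near: "\<bar>real n * \<gamma> - of_int h\<bar> < 1 / real n" by simp
  have "1 / real n \<le> 1" "real n * \<gamma> > 0" using n \<gamma> by auto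
  hence "real_of_int h > -1" using near by linarith
  hence h: "h \<ge> 0" by linarith
  define m where "m = nat h"
  have m: "real m = of_int h" using h by (simp add: m_def)
  note near = near[folded m]
  define t where "t = m * P + n * Q"
  define e where "e = real t * \<alpha> - real (m * P)"
  have e: "e = real P * (1 - \<alpha>) * (real n * \<gamma> - real m)"
    using \<alpha> PQ by (simp add: e_def t_def \<gamma>_def field_simps)
  have "real n * \<gamma> \<noteq> real m"
  proof
    assume "real n * \<gamma> = real m"
    hence "\<gamma> = real m / real n" using n by (simp add: field_simps)
    thus False using \<open>\<gamma> \<notin> \<rat>\<close> by simp
  qed
  hence e0: "e \<noteq> 0" using \<alpha> PQ by (simp add: e)
  have c: "real P * (1 - \<alpha>) > 0" using \<alpha> PQ by simp
  have e_le: "\<bar>e\<bar> \<le> real P * (1 - \<alpha>) / real n"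
  proof -
    have "\<bar>e\<bar> = real P * (1 - \<alpha>) * \<bar>real n * \<gamma> - real m\<bar>" unfolding e using \<alpha> by (simp add: abs_mult)
    also have "\<dots> \<le> real P * (1 - \<alpha>) * (1 / real n)" using near c by (intro mult_left_mono) auto
    finally show ?thesis by simp
  qed
  have nb: "real n > real T" "real n > 6 / \<eta>" "real n > 2 * (real P)\<^sup>2 / \<eta>" "real n > real P" "real n \<ge> 1"
    using hk(2) N unfolding n by linarith+
  have "real P * (1 - \<alpha>) \<le> real P" using \<alpha> PQ by simp
  hence "real P * (1 - \<alpha>) / real n < 1" using nb n by (simp add: divide_less_eq)
  hence e1: "\<bar>e\<bar> < 1" using e_le by linarith
  obtain i L where L: "real L \<ge> 1 / \<bar>e\<bar> - 2" "\<forall>j<L. w (i + j) = w (i + t + j)"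
    using interleaved_run[OF il y z bal t_def e_def e0 e1] by blast
  have tn: "real t \<ge> real n"
  proof -
    have "n * 1 \<le> n * Q" using PQ by (intro mult_le_mono2) auto
    hence "n \<le> t" unfolding t_def by linarith
    thus ?thesis by simp
  qed
  define \<delta> where "\<delta> = (real P)\<^sup>2 / real n"
  have \<delta>: "\<delta> \<le> \<eta> / 2" "\<delta> \<ge> 0" using nb(3) n(2) \<eta> by (auto simp: \<delta>_def field_simps)
  have PQ1: "real (P * Q) \<ge> 1" using PQ by (metis One_nat_def Suc_leI nat_0_less_mult_iff of_nat_1 of_nat_le_iff)
  have te: "real t * \<bar>e\<bar> \<le> real (P * Q) + \<delta>"
  proof -
    have "real m \<le> real n * \<gamma> + 1 / real n" using near by linarith
    hence "real m * real P \<le> (real n * \<gamma> + 1 / real n) * real P" by (rule mult_right_mono) simp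
    hence "real t \<le> (real n * \<gamma> + 1 / real n) * real P + real n * real Q" by (simp add: t_def)
    also have "\<dots> = real n * real Q / (1 - \<alpha>) + real P / real n"
      using \<alpha> PQ n by (simp add: \<gamma>_def field_simps)
    finally have "real t * \<bar>e\<bar> \<le> (real n * real Q / (1 - \<alpha>) + real P / real n) * (real P * (1 - \<alpha>) / real n)"
      using e_le by (intro mult_mono) auto
    also have "\<dots> = real (P * Q) + (real P)\<^sup>2 * (1 - \<alpha>) / (real n)\<^sup>2"
      using \<alpha> n by (simp add: field_simps power2_eq_square)
    also have "(real P)\<^sup>2 * (1 - \<alpha>) / (real n)\<^sup>2 \<le> (real P)\<^sup>2 / real n"
    proof (rule frac_le)
      show "(real P)\<^sup>2 * (1 - \<alpha>) \<le> (real P)\<^sup>2" by (rule mult_left_le) (use \<alpha> in auto)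
      show "real n \<le> (real n)\<^sup>2" using nb(5) by (simp add: power2_eq_square)
    qed (use n in auto)
    finally show ?thesis by (simp add: \<delta>_def)
  qed
  define N' where "N' = real (P * Q)"
  note PQ1 = PQ1[folded N'_def] and te = te[folded N'_def]
  have "1 / N' - \<delta> \<le> 1 / (N' + \<delta>)"
  proof -
    have "(1 / N' - \<delta>) * (N' + \<delta>) = 1 + \<delta> / N' - \<delta> * N' - \<delta> * \<delta>" using PQ1 by (simp add: field_simps)
    also have "\<dots> \<le> 1"
    proof -
      have *: "\<delta> \<le> \<delta> * N'" using mult_left_mono[OF PQ1 \<delta>(2)] by simp
      hence "\<delta> / N' \<le> \<delta>" using PQ1 by (simp add: divide_le_eq)
      note * this
      moreover have "\<delta> * \<delta> \<ge> 0" by simp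
      ultimately show ?thesis by linarith
    qed
    finally show ?thesis using PQ1 \<delta> by (simp add: pos_le_divide_eq)
  qed
  hence "real t * (1 / N' - \<delta>) \<le> real t * (1 / (N' + \<delta>))" by (rule mult_left_mono) simp
  also have "\<dots> \<le> 1 / \<bar>e\<bar>" using te e0 PQ1 \<delta> by (simp add: field_simps)
  finally have 1: "real t * (1 / N' - \<delta>) \<le> 1 / \<bar>e\<bar>" .
  have "real t * (\<eta> / 2) \<ge> 2"
  proof -
    have "real n * \<eta> \<ge> 6" using nb(2) \<eta> by (simp add: field_simps)
    moreover have "real t * \<eta> \<ge> real n * \<eta>" using tn \<eta> by simp
    ultimately show ?thesis by linarith
  qed
  moreover have "real t * \<delta> \<le> real t * (\<eta> / 2)" using \<delta>(1) by (rule mult_left_mono) simp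
  ultimately have "real t * (1 / N' - \<eta>) \<le> real t * (1 / N' - \<delta>) - 2"
    by (simp add: algebra_simps)
  hence "real L \<ge> real t * (1 / N' - \<eta>)" using 1 L(1) by linarith
  moreover have "t > T" using tn nb(1) by linarith
  ultimately show ?thesis using L(2) unfolding N'_def by blast
qed

section \<open>From runs of agreement to critical exponents\<close>

lemma critical_exponent_at_ge:
  assumes t: "t > 0" and run: "\<And>j. j < L \<Longrightarrow> v (i + j) = v (i + t + j)"
  shows "critical_exponent_at v t \<ge> ereal (1 + real L / real t)"
proof -
  define u where "u = v [i \<rightarrow> i + t]"
  have u: "u \<noteq> []" "length u = t" using t by (auto simp: u_def)
  \<comment> \<open>Agreement at distance \<open>t\<close> along the run copies the first
    \<open>t\<close> letters over the whole stretch of length \<open>t + L\<close>.\<close>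
  have per: "v (i + j) = v (i + j mod t)" if "j < t + L" for j
    using that
  proof (induction j rule: less_induct)
    case (less j)
    show ?case
    proof (cases "j < t")
      case False
      hence "v (i + j) = v (i + (j - t))" using run[of "j - t"] less.prems by simp
      also have "\<dots> = v (i + (j - t) mod t)" using False t less.prems by (intro less.IH) auto
      also have "(j - t) mod t = j mod t" using False by (simp add: le_mod_geq)
      finally show ?thesis .
    qed simp
  qed
  have "prefix (t + L) (u\<^sup>\<omega>) = v [i \<rightarrow> i + (t + L)]"
  proof (rule nth_equalityI)
    fix j assume "j < length (prefix (t + L) (u\<^sup>\<omega>))"
    hence j: "j < t + L" by simp
    have "j mod t < t" using t by simp
    hence "u ! (j mod t) = v (i + j mod t)" by (simp add: u_def)
    thus "prefix (t + L) (u\<^sup>\<omega>) ! j = v [i \<rightarrow> i + (t + L)] ! j" using per[OF j] j t u by simp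
  qed simp
  hence "prefix (t + L) (u\<^sup>\<omega>) \<in> factors v" by (auto simp: factors_def intro!: exI)
  hence e: "of_nat (t + L) / of_nat t \<in> power_exponents v u" unfolding power_exponents_def using t u(2) by blast
  have "ereal (of_rat (of_nat (t + L) / of_nat t)) \<le> critical_exponent_at v t"
    unfolding critical_exponent_at_def by (rule Sup_upper) (use e u in blast)
  moreover have "of_rat (of_nat (t + L) / of_nat t) = 1 + real L / real t"
    using t by (simp add: of_rat_divide of_rat_add field_simps)
  ultimately show ?thesis by simp
qed

lemma critical_exponent_at_le: "critical_exponent_at v t \<le> critical_exponent v"
  unfolding critical_exponent_at_def critical_exponent_def by (rule Sup_subset_mono) blast

text \<open>One fixed \<open>t\<close> admits arbitrarily long runs, so the critical exponent is
  infinite, and the asymptotic one is then infinite by definition.\<close>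

lemma eventually_periodic_imp_infinite_exponent:
  assumes t: "t > 0" and per: "\<And>i. v (k + (i + t)) = v (k + i)"
  shows "asymptotic_critical_exponent v = \<infinity>"
proof -
  have "ereal B \<le> critical_exponent v" for B
  proof -
    obtain L :: nat where L: "B * real t \<le> real L" using real_arch_simple by blast
    have "B \<le> real L / real t" using L t by (simp add: pos_le_divide_eq)
    hence "ereal B \<le> ereal (1 + real L / real t)" by simp
    also have "\<dots> \<le> critical_exponent_at v t"
      by (rule critical_exponent_at_ge[OF t, where i = k]) (use per in \<open>simp add: ac_simps\<close>)
    also have "\<dots> \<le> critical_exponent v" by (rule critical_exponent_at_le)
    finally show ?thesis .
  qed
  hence "critical_exponent v = \<infinity>" by (rule ereal_top)
  thus ?thesis by (simp add: asymptotic_critical_exponent_def)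
qed

lemma asymptotic_critical_exponent_ge:
  assumes "\<And>\<eta> T. \<eta> > 0 \<Longrightarrow> \<exists>t>T. critical_exponent_at v t \<ge> ereal (c - \<eta>)"
  shows "asymptotic_critical_exponent v \<ge> ereal c"
proof -
  have eps: "ereal c \<le> (SUP t\<in>{T..}. critical_exponent_at v t) + ereal \<eta>" if "\<eta> > 0" for \<eta> T
  proof -
    obtain t where t: "t > T" "critical_exponent_at v t \<ge> ereal (c - \<eta>)" using assms[OF \<open>\<eta> > 0\<close>] by blast
    note t(2)
    also have "critical_exponent_at v t \<le> (SUP t\<in>{T..}. critical_exponent_at v t)"
      by (rule SUP_upper) (use t(1) in auto)
    finally have "ereal (c - \<eta>) + ereal \<eta> \<le> (SUP t\<in>{T..}. critical_exponent_at v t) + ereal \<eta>"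
      by (rule add_right_mono)
    thus ?thesis by simp
  qed
  have "ereal c \<le> (SUP t\<in>{T..}. critical_exponent_at v t)" for T by (rule ereal_le_epsilon2, rule eps)
  hence "ereal c \<le> limsup (critical_exponent_at v)" unfolding limsup_INF_SUP by (rule INF_greatest)
  thus ?thesis by (simp add: asymptotic_critical_exponent_def)
qed

text \<open>Equality of all thresholds makes the gaps constant in both subwords. The given periods
  \<open>P\<close> and \<open>Q\<close>, on which there is no bound, can then be replaced by
  \<open>p\<close> and \<open>q\<close> with product at most
  \<open>2 ^ (card (range w) - 2)\<close>.\<close>

lemma (in frequencies) long_runs:
  assumes il: "interleaves w A y z" and P: "P > 0" "\<And>n. y (n + P) = y n" and Q: "Q > 0" "\<And>n. z (n + Q) = z n"
    and irr: "\<exists>a\<in>range y. \<rho> a \<notin> \<rat>"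
  shows "card (range w) \<ge> 2" 
    and "\<eta> > 0 \<Longrightarrow> \<exists>t>T. \<exists>i L. real L \<ge> real t * (1 / 2 ^ (card (range w) - 2) - \<eta>) \<and> (\<forall>j<L. w (i + j) = w (i + t + j))"
proof -
  have W: "w i = (if w i \<in> A then y (cnt A w i) else z (cnt (- A) w i))" for i
    using il unfolding interleaves_def by blast
  have ry: "range y = range w \<inter> A" and rz: "range z = range w \<inter> - A" using il by (auto simp: interleaves_def)
  have yA: "\<forall>i. w i \<in> A \<longrightarrow> y (cnt A w i) = w i" using W by metis
  have zA: "\<forall>i. w i \<in> - A \<longrightarrow> z (cnt (- A) w i) = w i" using W by (metis ComplD)
  define \<alpha> where "\<alpha> = (\<Sum>a\<in>range y. \<rho> a)"
  define \<beta> where "\<beta> = (\<Sum>a\<in>range z. \<rho> a)"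
  have un: "range w = range y \<union> range z" "range y \<inter> range z = {}" using ry rz by auto
  have finyz: "finite (range y)" "finite (range z)" using fin un by auto
  have "\<alpha> + \<beta> = 1" using sum_freq finyz un(2) unfolding un(1) \<alpha>_def \<beta>_def by (simp add: sum.union_disjoint)
  hence \<beta>: "\<beta> = 1 - \<alpha>" by simp
  note ty = subword_thresholds[OF yA ry P, folded \<alpha>_def]
  note tz = subword_thresholds[OF zA rz Q, folded \<beta>_def]
  have \<alpha>: "0 < \<alpha>" "\<alpha> < 1" using ty(1) tz(1) \<beta> by auto
  have \<alpha>irr: "\<alpha> \<notin> \<rat>"
  proof
    assume "\<alpha> \<in> \<rat>"
    moreover obtain a where a: "a \<in> range y" "\<rho> a \<notin> \<rat>" using irr by blast
    ultimately show False using ty(2)[OF a(1)] by auto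
  qed
  obtain \<phi> where \<phi>: "\<And>n. \<phi> (n + P) = \<phi> n"
      "\<And>i. \<phi> (cnt A w i) \<le> real (cnt A w i) - real i * \<alpha>"
      "\<And>i. w i \<in> A \<Longrightarrow> real (cnt A w i) - real i * \<alpha> \<le> \<phi> (cnt A w i) + \<alpha>"
      "\<And>i. w i \<notin> A \<Longrightarrow> real (cnt A w i) - real i * \<alpha> \<ge> \<phi> (cnt A w i) + \<alpha>"
    and gy: "(\<forall>n n'. \<phi> n = \<phi> n') \<Longrightarrow> (\<forall>a\<in>range y. \<exists>f>0. \<forall>n n'. y n = a \<longrightarrow> y n' = a \<longrightarrow>
         real (cnt {a} y n) - real (cnt {a} y n') = f * (real n - real n'))"
    using ty(3) by blast
  obtain \<psi> where \<psi>: "\<And>n. \<psi> (n + Q) = \<psi> n"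
      "\<And>i. \<psi> (cnt (- A) w i) \<le> real (cnt (- A) w i) - real i * \<beta>"
      "\<And>i. w i \<in> - A \<Longrightarrow> real (cnt (- A) w i) - real i * \<beta> \<le> \<psi> (cnt (- A) w i) + \<beta>"
      "\<And>i. w i \<notin> - A \<Longrightarrow> real (cnt (- A) w i) - real i * \<beta> \<ge> \<psi> (cnt (- A) w i) + \<beta>"
    and gz: "(\<forall>n n'. \<psi> n = \<psi> n') \<Longrightarrow> (\<forall>a\<in>range z. \<exists>f>0. \<forall>n n'. z n = a \<longrightarrow> z n' = a \<longrightarrow>
         real (cnt {a} z n) - real (cnt {a} z n') = f * (real n - real n'))"
    using tz(3) by blast
  have dual: "real (cnt (- A) w i) - real i * \<beta> = - (real (cnt A w i) - real i * \<alpha>)" for i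
    using cnt_compl[of A w i] by (simp add: \<beta> of_nat_diff algebra_simps)
  \<comment> \<open>Heights of the complement are the negatives of those of \<open>A\<close>, so its
    lower threshold \<open>\<psi>\<close> becomes an upper one. The offset 1 brings the decision
    level of the complement to \<open>\<mu> + \<alpha>\<close>, matching
    \<open>\<phi> + \<alpha>\<close>.\<close>
  define \<mu> where "\<mu> n = - \<psi> n - 1" for n
  have hi: "real (cnt A w i) - real i * \<alpha> \<le> \<mu> (cnt (- A) w i) + 1" for i
    using \<psi>(2)[of i] unfolding dual \<mu>_def by linarith
  have unb: "\<exists>i. cnt A w i > n" "\<exists>i. cnt (- A) w i > n" for n
    by (rule cnt_unbounded[of "y 0"], use ry in auto) (rule cnt_unbounded[of "z 0"], use rz in auto)
  have const: "\<phi> n = \<mu> m" for n m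
  proof (rule lattice_path_thresholds_constant[where w = w and A = A and P = P and Q = Q, OF \<alpha> \<alpha>irr P(1) Q(1) \<phi>(1) _ \<phi>(2) hi \<phi>(3) _ \<phi>(4) _ unb])
    show "\<mu> (n + Q) = \<mu> n" for n by (simp add: \<mu>_def \<psi>(1))
    show "real (cnt A w i) - real i * \<alpha> \<le> \<mu> (cnt (- A) w i) + \<alpha>" if "w i \<in> A" for i
      using \<psi>(4)[of i] that \<beta> unfolding dual \<mu>_def by auto
    show "\<mu> (cnt (- A) w i) + \<alpha> \<le> real (cnt A w i) - real i * \<alpha>" if "w i \<notin> A" for i
      using \<psi>(3)[of i] that \<beta> unfolding dual \<mu>_def by auto
  qed
  have c1: "\<forall>n n'. \<phi> n = \<phi> n'" using const by metis
  have c2: "\<forall>n n'. \<psi> n = \<psi> n'" using const unfolding \<mu>_def by (metis add_diff_cancel_right' diff_add_cancel minus_minus)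
  obtain p where p: "p > 0" "p \<le> 2 ^ (card (range y) - 1)" "\<And>n. y (n + p) = y n"
    using constant_gaps_short_period[of P y, OF P finyz(1)] gy[OF c1] by blast
  obtain q where q: "q > 0" "q \<le> 2 ^ (card (range z) - 1)" "\<And>n. z (n + q) = z n"
    using constant_gaps_short_period[of Q z, OF Q finyz(2)] gz[OF c2] by blast
  \<comment> \<open>The common value of the thresholds confines all heights of \<open>A\<close> to
    an interval of length 1.\<close>
  have bal: "\<bar>(real (cnt A w i) - real i * \<alpha>) - (real (cnt A w j) - real j * \<alpha>)\<bar> \<le> 1" for i j
    using \<phi>(2)[of i] hi[of i] \<phi>(2)[of j] hi[of j] const[of "cnt A w i" "cnt (- A) w i"]
      const[of "cnt A w i" "cnt (- A) w j"] const[of "cnt A w j" "cnt (- A) w i"] by linarith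
  have cc: "card (range w) = card (range y) + card (range z)" "card (range y) > 0" "card (range z) > 0"
    using finyz un by (auto simp: card_Un_disjoint card_gt_0_iff)
  show "card (range w) \<ge> 2" using cc by linarith
  have "p * q \<le> 2 ^ (card (range y) - 1) * 2 ^ (card (range z) - 1)"
    using p(2) q(2) by (rule mult_le_mono)
  also have "\<dots> = 2 ^ (card (range w) - 2)"
    using cc by (simp flip: power_add)
  finally have "real (p * q) \<le> 2 ^ (card (range w) - 2)" by (metis of_nat_le_iff of_nat_numeral of_nat_power)
  hence le: "1 / 2 ^ (card (range w) - 2) \<le> 1 / real (p * q)" using p(1) q(1) by (intro divide_left_mono) auto
  assume "\<eta> > 0"
  from interleaved_long_runs[where T = T, OF il p(3) q(3) bal \<alpha> \<alpha>irr p(1) q(1) this]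
  obtain t i L where t: "t > T" "real L \<ge> real t * (1 / real (p * q) - \<eta>)" "\<forall>j<L. w (i + j) = w (i + t + j)"
    by blast
  have "real t * (1 / 2 ^ (card (range w) - 2) - \<eta>) \<le> real t * (1 / real (p * q) - \<eta>)"
    using le by (intro mult_left_mono) auto
  thus "\<exists>t>T. \<exists>i L. real L \<ge> real t * (1 / 2 ^ (card (range w) - 2) - \<eta>) \<and> (\<forall>j<L. w (i + j) = w (i + t + j))"
    using t order_trans by blast
qed

text \<open>If all frequencies are rational, the exponent is infinite. Otherwise runs in a tail are
  runs of \<open>v\<close>, and a word using fewer than \<open>card A\<close> letters satisfies an
  even stronger bound.\<close>

lemma balanced_asymptotic_critical_exponent_ge:
  fixes v :: "'a word"
  assumes A: "finite A" "range v \<subseteq> A" and bal: "balanced v"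
  shows "asymptotic_critical_exponent v \<ge> ereal (1 + 1 / 2 powi (int (card A) - 2))"
proof -
  have finv: "finite (range v)" using A finite_subset by blast
  obtain k \<rho> x where "frequencies (\<lambda>n. v (k + n)) \<rho> x" using balanced_imp_frequencies[OF bal finv] by blast
  then interpret w: frequencies "\<lambda>n. v (k + n)" \<rho> x .
  let ?w = "\<lambda>n. v (k + n)" and ?w' = "\<lambda>n. v (k + (1 + n))"
  show ?thesis
  proof (cases "\<forall>a\<in>range ?w. \<rho> a \<in> \<rat>")
    case True
    then obtain t where "t > 0" "\<And>i. v (k + (i + t)) = v (k + i)" using w.rational_imp_periodic by blast
    thus ?thesis using eventually_periodic_imp_infinite_exponent[of t v k] by simp
  next
    case False
    then obtain a0 where "a0 \<in> range ?w" "\<rho> a0 \<notin> \<rat>" by blast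
    from w.exists_interleaving[OF this] obtain S y z P Q where il: "interleaves ?w' S y z" "P > 0" "Q > 0"
      "\<And>n. y (n + P) = y n" "\<And>n. z (n + Q) = z n" "\<exists>a\<in>range y. \<rho> a \<notin> \<rat>" by blast
    obtain x' where "frequencies ?w' \<rho> x'" using w.frequencies_shift[of 1] by blast
    then interpret w': frequencies ?w' \<rho> x' .
    note runs = w'.long_runs[OF il(1,2,4,3,5,6)]
    have "card (range ?w') \<le> card A" using A by (intro card_mono) auto
    \<comment> \<open>At least two letters occur here, so the integer exponent is a natural number;
      a one-letter alphabet falls under the periodic case.\<close>
    hence d: "card A \<ge> 2" "card (range ?w') - 2 \<le> card A - 2" using runs(1) by linarith+
    have "(2::real) powi (int (card A) - 2) = 2 ^ (card A - 2)"
      using d(1) by (simp add: power_int_def nat_diff_distrib)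
    moreover have "1 / (2::real) ^ (card A - 2) \<le> 1 / 2 ^ (card (range ?w') - 2)"
      using d(2) by (intro divide_left_mono power_increasing) auto
    ultimately have le: "1 / (2::real) powi (int (card A) - 2) \<le> 1 / 2 ^ (card (range ?w') - 2)" by simp
    show ?thesis
    proof (rule asymptotic_critical_exponent_ge)
      fix \<eta> :: real and T :: nat assume "\<eta> > 0"
      from runs(2)[OF this, of T] obtain t i L where t: "t > T" 
        "real L \<ge> real t * (1 / 2 ^ (card (range ?w') - 2) - \<eta>)" "\<forall>j<L. ?w' (i + j) = ?w' (i + t + j)" by blast
      have "real L / real t \<ge> 1 / 2 ^ (card (range ?w') - 2) - \<eta>"
        using t(1,2) by (simp add: pos_le_divide_eq mult.commute)
      hence "ereal (1 + 1 / 2 powi (int (card A) - 2) - \<eta>) \<le> ereal (1 + real L / real t)" using le by simp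
      also have "\<dots> \<le> critical_exponent_at v t"
      proof (rule critical_exponent_at_ge)
        show "v ((k + 1 + i) + j) = v ((k + 1 + i) + t + j)" if "j < L" for j
          using t(3) that by (simp add: add.assoc)
      qed (use t(1) in simp)
      finally show "\<exists>t>T. ereal (1 + 1 / 2 powi (int (card A) - 2) - \<eta>) \<le> critical_exponent_at v t"
        using t(1) by blast
    qed
  qed
qed

theorem corollary15:
  fixes d :: nat
  assumes "d \<ge> 1"
  shows "RTB_star d \<ge> ereal (1 + 1 / (2::real) powi (int d - 2))"
  unfolding RTB_star_def
  by (rule Inf_greatest) (auto intro: balanced_asymptotic_critical_exponent_ge)

end
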